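(* Let $k$ be a field, let $A$ be an associative finite dimensional unital $k$-algebra, and let $S$ and $T$ be simple $A$-modules without non-trivial self-extensions (i.e. $\mathrm{Ext}^1_A(S,S)=0$ and $\mathrm{Ext}^1_A(T,T)=0$). Let $\mathsf{P}_S,\mathsf{P}_T$ be the associated projection functors. Then, where "$=$" between functors means that they are naturally isomorphic: (a) $\mathsf{P}_S\circ \mathsf{P}_S=\mathsf{P}_S$. (b) If $\mathrm{Ext}^1_A(T,S)=0$, then $\mathsf{P}_S\circ\mathsf{P}_T\circ\mathsf{P}_S=\mathsf{P}_T\circ\mathsf{P}_S\circ\mathsf{P}_T=\mathsf{P}_S\circ\mathsf{P}_T$.
   Context: $A\text{-mod}$ is the category of finite dimensional left $A$-modules. For $U\in A\text{-mod}$, $\mathrm{gen}\text{-}U$ is the full subcategory of modules isomorphic to a quotient of some $U^{\oplus d}$, $d\ge 0$. For $M\in A\text{-mod}$, $\mathsf{t}_U(M)$ is the greatest submodule of $M$ lying in $\mathrm{gen}\text{-}U$; this defines a subfunctor $\mathsf{t}_U$ of the identity functor. The projection functor $\mathsf{P}_U\colon A\text{-mod}\to A\text{-mod}$ is the cokernel of the inclusion $\mathsf{t}_U\to \mathrm{id}$, i.e. $\mathsf{P}_U(M)=M/\mathsf{t}_U(M)$, and $\mathsf{P}_U(\varphi)$ is the map induced by $\varphi$ on quotients. *)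

theory Defs
  imports "Jordan_Normal_Form.Missing_VectorSpace" "HOL-Algebra.QuotRing"
begin

section \<open>Algebras and modules\<close>

text \<open>
  The locales \<open>algebra\<close> and \<open>module\<close> of HOL-Algebra require commutative rings, so
  the non-commutative versions are introduced here, on the same record type. As for library
  modules, the fields \<open>mult\<close> and \<open>one\<close> of a module are irrelevant; for an algebra they
  are its multiplication and its unit.
\<close>

locale fd_algebra = V?: vectorspace K A + R?: ring A
  for K :: "'k ring" and A :: "('k, 'a) module" (structure) +
  assumes smult_assoc2:
      "\<lbrakk>c \<in> carrier K; a \<in> carrier A; b \<in> carrier A\<rbrakk> \<Longrightarrow> (c \<odot> a) \<otimes> b = c \<odot> (a \<otimes> b)"
    and smult_assoc3:
      "\<lbrakk>c \<in> carrier K; a \<in> carrier A; b \<in> carrier A\<rbrakk> \<Longrightarrow> a \<otimes> (c \<odot> b) = c \<odot> (a \<otimes> b)"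
    and algebra_fin_dim: "vectorspace.fin_dim K A"

locale left_module = R?: ring R + M?: abelian_group M
  for R :: "('a, 'r) ring_scheme" (structure) and M :: "('a, 'm) module" (structure) +
  assumes smult_closed:
      "\<lbrakk>a \<in> carrier R; x \<in> carrier M\<rbrakk> \<Longrightarrow> a \<odot>\<^bsub>M\<^esub> x \<in> carrier M"
    and smult_l_distr:
      "\<lbrakk>a \<in> carrier R; b \<in> carrier R; x \<in> carrier M\<rbrakk> \<Longrightarrow>
        (a \<oplus> b) \<odot>\<^bsub>M\<^esub> x = a \<odot>\<^bsub>M\<^esub> x \<oplus>\<^bsub>M\<^esub> b \<odot>\<^bsub>M\<^esub> x"
    and smult_r_distr:
      "\<lbrakk>a \<in> carrier R; x \<in> carrier M; y \<in> carrier M\<rbrakk> \<Longrightarrow>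
        a \<odot>\<^bsub>M\<^esub> (x \<oplus>\<^bsub>M\<^esub> y) = a \<odot>\<^bsub>M\<^esub> x \<oplus>\<^bsub>M\<^esub> a \<odot>\<^bsub>M\<^esub> y"
    and smult_assoc1:
      "\<lbrakk>a \<in> carrier R; b \<in> carrier R; x \<in> carrier M\<rbrakk> \<Longrightarrow>
        (a \<otimes> b) \<odot>\<^bsub>M\<^esub> x = a \<odot>\<^bsub>M\<^esub> (b \<odot>\<^bsub>M\<^esub> x)"
    and smult_one: "x \<in> carrier M \<Longrightarrow> \<one> \<odot>\<^bsub>M\<^esub> x = x"

text \<open>The underlying \<open>K\<close>-vector space of an \<open>A\<close>-module, via \<open>c \<mapsto> c 1\<^sub>A\<close>.\<close>

definition underlying_space :: "('k, 'a) module \<Rightarrow> ('a, 'm) module \<Rightarrow> ('k, 'm) module" where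
  "underlying_space A M =
     \<lparr>carrier = carrier M, mult = mult M, one = one M, zero = zero M, add = add M,
      smult = (\<lambda>c x. (c \<odot>\<^bsub>A\<^esub> \<one>\<^bsub>A\<^esub>) \<odot>\<^bsub>M\<^esub> x)\<rparr>"

definition fd_module :: "'k ring \<Rightarrow> ('k, 'a) module \<Rightarrow> ('a, 'm) module \<Rightarrow> bool" where
  "fd_module K A M \<longleftrightarrow> left_module A M \<and> vectorspace.fin_dim K (underlying_space A M)"

text \<open>
  \<open>Module.submodule\<close> is the HOL-Algebra notion; the AFP notion of the same name would
  force the scalars to be commutative.
\<close>

definition simple_module :: "('k, 'a) module \<Rightarrow> ('a, 'm) module \<Rightarrow> bool" where
  "simple_module A S \<longleftrightarrow> left_module A S \<and> carrier S \<noteq> {\<zero>\<^bsub>S\<^esub>} \<and>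
     (\<forall>N. Module.submodule N A S \<longrightarrow> N = {\<zero>\<^bsub>S\<^esub>} \<or> N = carrier S)"

definition module_iso ::
    "('k, 'a) module \<Rightarrow> ('a, 'm) module \<Rightarrow> ('a, 'n) module \<Rightarrow> ('m \<Rightarrow> 'n) set" where
  "module_iso A M N = {f \<in> module_hom A M N. bij_betw f (carrier M) (carrier N)}"

definition quotient_module :: "('a, 'm) module \<Rightarrow> 'm set \<Rightarrow> ('a, 'm set) module" where
  "quotient_module M N =
     \<lparr>carrier = a_rcosets\<^bsub>M\<^esub> N, mult = rcoset_mult M N, one = N +>\<^bsub>M\<^esub> \<one>\<^bsub>M\<^esub>,
      zero = N, add = set_add M,
      smult = (\<lambda>a X. \<Union>x\<in>X. N +>\<^bsub>M\<^esub> (a \<odot>\<^bsub>M\<^esub> x))\<rparr>"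

text \<open>The direct sum of \<open>d\<close> copies of \<open>U\<close>.\<close>

definition power_module :: "('a, 'u) module \<Rightarrow> nat \<Rightarrow> ('a, nat \<Rightarrow> 'u) module" where
  "power_module U d =
     \<lparr>carrier = {..<d} \<rightarrow>\<^sub>E carrier U,
      mult = (\<lambda>f g. \<lambda>i\<in>{..<d}. \<zero>\<^bsub>U\<^esub>), one = (\<lambda>i\<in>{..<d}. \<zero>\<^bsub>U\<^esub>),
      zero = (\<lambda>i\<in>{..<d}. \<zero>\<^bsub>U\<^esub>),
      add = (\<lambda>f g. \<lambda>i\<in>{..<d}. f i \<oplus>\<^bsub>U\<^esub> g i),
      smult = (\<lambda>a f. \<lambda>i\<in>{..<d}. a \<odot>\<^bsub>U\<^esub> f i)\<rparr>"


section \<open>First extension groups\<close>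

text \<open>
  Yoneda's \<open>Ext\<^sup>1(X, Y)\<close>: equivalence classes of short exact sequences
  \<open>0 \<rightarrow> Y \<rightarrow> E \<rightarrow> X \<rightarrow> 0\<close>. The middle term is taken with elements in \<open>'y \<times> 'x\<close>. This
  loses nothing: a set-theoretic section of \<open>E \<rightarrow> X\<close> gives a bijection of \<open>E\<close> with
  \<open>Y \<times> X\<close>, along which the structure of \<open>E\<close> can be transported.
\<close>

type_synonym ('a, 'x, 'y) extension =
  "('a, 'y \<times> 'x) module \<times> ('y \<Rightarrow> 'y \<times> 'x) \<times> ('y \<times> 'x \<Rightarrow> 'x)"

definition extensions ::
    "('k, 'a) module \<Rightarrow> ('a, 'x) module \<Rightarrow> ('a, 'y) module \<Rightarrow> ('a, 'x, 'y) extension set" where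
  "extensions A X Y = {(E, i, p). left_module A E \<and>
     i \<in> module_hom A Y E \<and> p \<in> module_hom A E X \<and>
     inj_on i (carrier Y) \<and> i ` carrier Y = a_kernel E X p \<and> p ` carrier E = carrier X}"

definition extension_equiv ::
    "('k, 'a) module \<Rightarrow> ('a, 'x) module \<Rightarrow> ('a, 'y) module \<Rightarrow> ('a, 'x, 'y) extension rel" where
  "extension_equiv A X Y = {((E, i, p), (E', i', p')).
     (E, i, p) \<in> extensions A X Y \<and> (E', i', p') \<in> extensions A X Y \<and>
     (\<exists>f \<in> module_iso A E E'. (\<forall>y \<in> carrier Y. f (i y) = i' y) \<and>
        (\<forall>e \<in> carrier E. p' (f e) = p e))}"

definition Ext1 ::
    "('k, 'a) module \<Rightarrow> ('a, 'x) module \<Rightarrow> ('a, 'y) module \<Rightarrow> ('a, 'x, 'y) extension set set" where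
  "Ext1 A X Y = extensions A X Y // extension_equiv A X Y"

text \<open>The zero of \<open>Ext\<^sup>1(X, Y)\<close> (for the Baer sum) is the class of the split extension.\<close>

definition Ext1_zero ::
    "('k, 'a) module \<Rightarrow> ('a, 'x) module \<Rightarrow> ('a, 'y) module \<Rightarrow> ('a, 'x, 'y) extension set" where
  "Ext1_zero A X Y = extension_equiv A X Y `` {(direct_sum Y X, inj1 Y X, snd)}"


section \<open>Functors on finite dimensional modules\<close>

text \<open>
  \<open>('a, 'm, 'n) mod_functor\<close> is the data of a functor from modules with elements in \<open>'m\<close>
  to modules with elements in \<open>'n\<close>. Homomorphisms are HOL functions that only matter on
  the carrier of the source, so the action on homomorphisms takes source and target as arguments,
  has to respect equality on carriers, and is compared on carriers only. The type \<open>'m\<close> is a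
  parameter; for instance, for \<open>'m = nat \<Rightarrow> 'k\<close> every finite dimensional module is isomorphic
  to one with elements in \<open>'m\<close>.
\<close>

record ('a, 'm, 'n) mod_functor =
  obj_map :: "('a, 'm) module \<Rightarrow> ('a, 'n) module"
  arr_map :: "('a, 'm) module \<Rightarrow> ('a, 'm) module \<Rightarrow> ('m \<Rightarrow> 'm) \<Rightarrow> 'n \<Rightarrow> 'n"

definition is_functor ::
    "'k ring \<Rightarrow> ('k, 'a) module \<Rightarrow> ('a, 'm, 'n) mod_functor \<Rightarrow> bool" where
  "is_functor K A F \<longleftrightarrow>
     (\<forall>M. fd_module K A M \<longrightarrow> fd_module K A (obj_map F M)) \<and>
     (\<forall>M N f. fd_module K A M \<and> fd_module K A N \<and> f \<in> module_hom A M N \<longrightarrow>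
        arr_map F M N f \<in> module_hom A (obj_map F M) (obj_map F N)) \<and>
     (\<forall>M N f g. fd_module K A M \<and> fd_module K A N \<and>
        f \<in> module_hom A M N \<and> g \<in> module_hom A M N \<and> (\<forall>x \<in> carrier M. f x = g x) \<longrightarrow>
        (\<forall>x \<in> carrier (obj_map F M). arr_map F M N f x = arr_map F M N g x)) \<and>
     (\<forall>M. fd_module K A M \<longrightarrow> (\<forall>x \<in> carrier (obj_map F M). arr_map F M M id x = x)) \<and>
     (\<forall>L M N f g. fd_module K A L \<and> fd_module K A M \<and> fd_module K A N \<and>
        f \<in> module_hom A L M \<and> g \<in> module_hom A M N \<longrightarrow>
        (\<forall>x \<in> carrier (obj_map F L).
           arr_map F L N (g \<circ> f) x = arr_map F M N g (arr_map F L M f x)))"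

definition functor_comp ::
    "('a, 'n, 'p) mod_functor \<Rightarrow> ('a, 'm, 'n) mod_functor \<Rightarrow> ('a, 'm, 'p) mod_functor"
    (infixl \<open>\<circ>\<^sub>F\<close> 55) where
  "G \<circ>\<^sub>F F =
     \<lparr>obj_map = (\<lambda>M. obj_map G (obj_map F M)),
      arr_map = (\<lambda>M N f. arr_map G (obj_map F M) (obj_map F N) (arr_map F M N f))\<rparr>"

definition naturally_isomorphic ::
    "'k ring \<Rightarrow> ('k, 'a) module \<Rightarrow> ('a, 'm, 'n) mod_functor \<Rightarrow> ('a, 'm, 'p) mod_functor \<Rightarrow> bool" where
  "naturally_isomorphic K A F G \<longleftrightarrow> is_functor K A F \<and> is_functor K A G \<and>
     (\<exists>\<eta>. (\<forall>M. fd_module K A M \<longrightarrow> \<eta> M \<in> module_iso A (obj_map F M) (obj_map G M)) \<and>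
          (\<forall>M N f. fd_module K A M \<and> fd_module K A N \<and> f \<in> module_hom A M N \<longrightarrow>
             (\<forall>x \<in> carrier (obj_map F M).
                \<eta> N (arr_map F M N f x) = arr_map G M N f (\<eta> M x))))"


section \<open>Projection functors\<close>

definition in_gen :: "('k, 'a) module \<Rightarrow> ('a, 'u) module \<Rightarrow> ('a, 'm) module \<Rightarrow> bool" where
  "in_gen A U N \<longleftrightarrow> left_module A N \<and>
     (\<exists>d L. Module.submodule L A (power_module U d) \<and>
        module_iso A N (quotient_module (power_module U d) L) \<noteq> {})"

definition trace_submodule :: "('k, 'a) module \<Rightarrow> ('a, 'u) module \<Rightarrow> ('a, 'm) module \<Rightarrow> 'm set" where
  "trace_submodule A U M =
     (GREATEST N. Module.submodule N A M \<and> in_gen A U (M\<lparr>carrier := N\<rparr>))"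

definition projection_functor ::
    "('k, 'a) module \<Rightarrow> ('a, 'u) module \<Rightarrow> ('a, 'm, 'm set) mod_functor" where
  "projection_functor A U =
     \<lparr>obj_map = (\<lambda>M. quotient_module M (trace_submodule A U M)),
      arr_map = (\<lambda>M N f X. \<Union>x\<in>X. trace_submodule A U N +>\<^bsub>N\<^esub> f x)\<rparr>"

end

theory Submission
  imports Defs
begin

text \<open>
  For a submodule \<open>N\<close> of \<open>M\<close> let \<open>L\<^sub>U(N)\<close> be the kernel of \<open>M \<rightarrow> P\<^sub>U(M / N)\<close>. A composite of projection
  functors sends \<open>M\<close> to \<open>M / L\<^sub>U(L\<^sub>V(\<dots> 0))\<close>, so natural isomorphisms reduce to equalities between
  such submodules. The operators \<open>L\<^sub>U\<close> are monotone and extensive. If \<open>Ext\<^sup>1(X, Y) = 0\<close> and \<open>Y\<close> is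
  simple, every homomorphism \<open>X \<rightarrow> M / L\<^sub>Y(N)\<close> lifts to \<open>X \<rightarrow> M / N\<close>, one copy of \<open>Y\<close> at a time, so
  \<open>L\<^sub>X(L\<^sub>Y(N)) \<subseteq> L\<^sub>X(N) + L\<^sub>Y(N)\<close>. In particular \<open>L\<^sub>S\<close> and \<open>L\<^sub>T\<close> are idempotent, and \<open>Ext\<^sup>1(T, S) = 0\<close>
  gives \<open>L\<^sub>T L\<^sub>S L\<^sub>T 0 = L\<^sub>S L\<^sub>T 0\<close> as well as
  \<open>L\<^sub>S L\<^sub>T L\<^sub>S 0 \<subseteq> L\<^sub>S (L\<^sub>S 0 + L\<^sub>T 0) \<subseteq> L\<^sub>S L\<^sub>S L\<^sub>T 0 = L\<^sub>S L\<^sub>T 0\<close>.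
\<close>

section \<open>Left modules and homomorphisms\<close>

text \<open>A homomorphism X \<rightarrow> M / N' lifts along M / N \<rightarrow> M / N' as soon as
  the extension obtained by pullback has trivial class in Ext^1(X, N' / N). For N' = L_Y(N) this
  kernel may contain many copies of Y, while the hypothesis speaks of a single copy; hence the
  passage one copy at a time. Simplicity of Y gives every step this shape, since a homomorphism Y
  \<rightarrow> M / N is zero or injective. Finite dimension ends the passage: a maximal submodule
  of L_Y(N) up to which lifting works has to be all of L_Y(N). The condition Ext^1(T, S) = 0 is not
  symmetric. It bounds L_T L_S N by L_S L_T N, so both words of length three are sorted towards L_S
  L_T. On the side of functors the obstacle is that composites of different length take values in
  different types of iterated cosets. The isomorphisms therefore come from the uniqueness of a
  quotient of M with given kernel, and they are natural because they commute with the surjections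
  from M.\<close>

context left_module
begin

lemma smult_zero_right:
  assumes "a \<in> carrier R" shows "a \<odot>\<^bsub>M\<^esub> \<zero>\<^bsub>M\<^esub> = \<zero>\<^bsub>M\<^esub>"
proof -
  have c: "a \<odot>\<^bsub>M\<^esub> \<zero>\<^bsub>M\<^esub> \<in> carrier M"
    using assms by (simp add: smult_closed)
  have "a \<odot>\<^bsub>M\<^esub> \<zero>\<^bsub>M\<^esub> \<oplus>\<^bsub>M\<^esub> a \<odot>\<^bsub>M\<^esub> \<zero>\<^bsub>M\<^esub> = a \<odot>\<^bsub>M\<^esub> \<zero>\<^bsub>M\<^esub>"
    using assms smult_r_distr[of a "\<zero>\<^bsub>M\<^esub>" "\<zero>\<^bsub>M\<^esub>"] by simp
  then show ?thesis
    using c M.add.l_cancel_one by blast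
qed

lemma smult_zero_left:
  assumes "x \<in> carrier M" shows "\<zero> \<odot>\<^bsub>M\<^esub> x = \<zero>\<^bsub>M\<^esub>"
proof -
  have c: "\<zero> \<odot>\<^bsub>M\<^esub> x \<in> carrier M"
    using assms by (simp add: smult_closed)
  have "\<zero> \<odot>\<^bsub>M\<^esub> x \<oplus>\<^bsub>M\<^esub> \<zero> \<odot>\<^bsub>M\<^esub> x = \<zero> \<odot>\<^bsub>M\<^esub> x"
    using assms smult_l_distr[of \<zero> \<zero> x] by simp
  then show ?thesis
    using c M.add.l_cancel_one by blast
qed

lemma smult_minus:
  assumes "a \<in> carrier R" "x \<in> carrier M"
  shows "a \<odot>\<^bsub>M\<^esub> (\<ominus>\<^bsub>M\<^esub> x) = \<ominus>\<^bsub>M\<^esub> (a \<odot>\<^bsub>M\<^esub> x)"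
proof -
  have "a \<odot>\<^bsub>M\<^esub> (\<ominus>\<^bsub>M\<^esub> x) \<oplus>\<^bsub>M\<^esub> a \<odot>\<^bsub>M\<^esub> x = \<zero>\<^bsub>M\<^esub>"
    using assms smult_r_distr[of a "\<ominus>\<^bsub>M\<^esub> x" x] smult_zero_right M.l_neg by simp
  then show ?thesis
    using assms smult_closed M.minus_equality M.a_inv_closed by metis
qed

lemma minus_one_smult:
  assumes "x \<in> carrier M" shows "(\<ominus> \<one>) \<odot>\<^bsub>M\<^esub> x = \<ominus>\<^bsub>M\<^esub> x"
proof -
  have "(\<ominus> \<one>) \<odot>\<^bsub>M\<^esub> x \<oplus>\<^bsub>M\<^esub> x = \<zero>\<^bsub>M\<^esub>"
    using assms smult_l_distr[of "\<ominus> \<one>" \<one> x] smult_one smult_zero_left R.l_neg by simp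
  then show ?thesis
    using assms smult_closed M.minus_equality R.a_inv_closed R.one_closed by metis
qed

text \<open>Closure under negatives follows from closure under scalars, because -x = (-1) x.\<close>

lemma submoduleI:
  assumes "N \<subseteq> carrier M" "\<zero>\<^bsub>M\<^esub> \<in> N"
    and "\<And>x y. x \<in> N \<Longrightarrow> y \<in> N \<Longrightarrow> x \<oplus>\<^bsub>M\<^esub> y \<in> N"
    and smult: "\<And>a x. a \<in> carrier R \<Longrightarrow> x \<in> N \<Longrightarrow> a \<odot>\<^bsub>M\<^esub> x \<in> N"
  shows "Module.submodule N R M"
proof -
  have "\<ominus>\<^bsub>M\<^esub> x \<in> N" if "x \<in> N" for x
    using that assms(1) minus_one_smult smult R.a_inv_closed R.one_closed by (metis subsetD)
  then show ?thesis
    using assms by unfold_locales (auto simp: a_inv_def)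
qed

lemma submoduleD:
  assumes "Module.submodule N R M"
  shows "N \<subseteq> carrier M" "\<zero>\<^bsub>M\<^esub> \<in> N"
    and "\<And>x y. x \<in> N \<Longrightarrow> y \<in> N \<Longrightarrow> x \<oplus>\<^bsub>M\<^esub> y \<in> N"
    and "\<And>a x. a \<in> carrier R \<Longrightarrow> x \<in> N \<Longrightarrow> a \<odot>\<^bsub>M\<^esub> x \<in> N"
    and "\<And>x. x \<in> N \<Longrightarrow> \<ominus>\<^bsub>M\<^esub> x \<in> N"
    and "\<And>x y. x \<in> N \<Longrightarrow> y \<in> N \<Longrightarrow> x \<ominus>\<^bsub>M\<^esub> y \<in> N"
proof -
  interpret N: Module.submodule N R M by fact
  show "N \<subseteq> carrier M" "\<zero>\<^bsub>M\<^esub> \<in> N" using N.subset N.one_closed by simp_all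
  show "\<And>x y. x \<in> N \<Longrightarrow> y \<in> N \<Longrightarrow> x \<oplus>\<^bsub>M\<^esub> y \<in> N" using N.m_closed by simp
  show "\<And>a x. a \<in> carrier R \<Longrightarrow> x \<in> N \<Longrightarrow> a \<odot>\<^bsub>M\<^esub> x \<in> N" by (rule N.smult_closed)
  show "\<And>x. x \<in> N \<Longrightarrow> \<ominus>\<^bsub>M\<^esub> x \<in> N" using N.m_inv_closed by (simp add: a_inv_def)
  then show "\<And>x y. x \<in> N \<Longrightarrow> y \<in> N \<Longrightarrow> x \<ominus>\<^bsub>M\<^esub> y \<in> N"
    using \<open>\<And>x y. x \<in> N \<Longrightarrow> y \<in> N \<Longrightarrow> x \<oplus>\<^bsub>M\<^esub> y \<in> N\<close> by (simp add: a_minus_def)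
qed

lemma submodule_zero: "Module.submodule {\<zero>\<^bsub>M\<^esub>} R M"
  by (rule submoduleI) (auto simp: smult_zero_right)

lemma submodule_carrier: "Module.submodule (carrier M) R M"
  by (rule submoduleI) (auto simp: smult_closed)

lemma submodule_Inter:
  assumes "\<C> \<noteq> {}" "\<And>N. N \<in> \<C> \<Longrightarrow> Module.submodule N R M"
  shows "Module.submodule (\<Inter>\<C>) R M"
proof (rule submoduleI)
  show "\<Inter>\<C> \<subseteq> carrier M"
    using assms submoduleD(1) by (meson Inf_lower2 all_not_in_conv)
qed (simp_all add: submoduleD[OF assms(2)])

lemma minus_cancel_right:
  assumes "x \<in> carrier M" "y \<in> carrier M" "z \<in> carrier M"
  shows "(x \<ominus>\<^bsub>M\<^esub> y) \<oplus>\<^bsub>M\<^esub> (y \<ominus>\<^bsub>M\<^esub> z) = x \<ominus>\<^bsub>M\<^esub> z"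
  using assms by (simp add: a_minus_def M.a_assoc M.r_neg1)

lemma minus_add_cancel:
  assumes "x \<in> carrier M" "y \<in> carrier M"
  shows "(x \<ominus>\<^bsub>M\<^esub> y) \<oplus>\<^bsub>M\<^esub> y = x"
  using assms by (simp add: a_minus_def M.a_assoc M.l_neg)

lemma minus_eq_zero_iff:
  assumes "x \<in> carrier M" "y \<in> carrier M"
  shows "x \<ominus>\<^bsub>M\<^esub> y = \<zero>\<^bsub>M\<^esub> \<longleftrightarrow> x = y"
  using assms by (metis M.minus_equality M.minus_minus a_minus_def M.a_inv_closed M.r_neg)

lemma smult_diff:
  assumes "a \<in> carrier R" "x \<in> carrier M" "y \<in> carrier M"
  shows "a \<odot>\<^bsub>M\<^esub> (x \<ominus>\<^bsub>M\<^esub> y) = a \<odot>\<^bsub>M\<^esub> x \<ominus>\<^bsub>M\<^esub> a \<odot>\<^bsub>M\<^esub> y"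
  using assms by (simp add: a_minus_def smult_r_distr smult_minus)

end

section \<open>Constructing left modules: transport of structure, submodules, direct sums,
  powers\<close>

lemma left_moduleI:
  fixes A (structure)
  assumes "ring A" and zero: "\<zero>\<^bsub>M\<^esub> \<in> carrier M"
    and add: "\<And>x y. x \<in> carrier M \<Longrightarrow> y \<in> carrier M \<Longrightarrow> x \<oplus>\<^bsub>M\<^esub> y \<in> carrier M"
    and smult: "\<And>a x. a \<in> carrier A \<Longrightarrow> x \<in> carrier M \<Longrightarrow> a \<odot>\<^bsub>M\<^esub> x \<in> carrier M"
    and assoc: "\<And>x y z. x \<in> carrier M \<Longrightarrow> y \<in> carrier M \<Longrightarrow> z \<in> carrier M \<Longrightarrow>
      (x \<oplus>\<^bsub>M\<^esub> y) \<oplus>\<^bsub>M\<^esub> z = x \<oplus>\<^bsub>M\<^esub> (y \<oplus>\<^bsub>M\<^esub> z)"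
    and comm: "\<And>x y. x \<in> carrier M \<Longrightarrow> y \<in> carrier M \<Longrightarrow> x \<oplus>\<^bsub>M\<^esub> y = y \<oplus>\<^bsub>M\<^esub> x"
    and add_zero: "\<And>x. x \<in> carrier M \<Longrightarrow> \<zero>\<^bsub>M\<^esub> \<oplus>\<^bsub>M\<^esub> x = x"
    and zero_smult: "\<And>x. x \<in> carrier M \<Longrightarrow> \<zero> \<odot>\<^bsub>M\<^esub> x = \<zero>\<^bsub>M\<^esub>"
    and l_distr: "\<And>a b x. a \<in> carrier A \<Longrightarrow> b \<in> carrier A \<Longrightarrow> x \<in> carrier M \<Longrightarrow>
      (a \<oplus> b) \<odot>\<^bsub>M\<^esub> x = a \<odot>\<^bsub>M\<^esub> x \<oplus>\<^bsub>M\<^esub> b \<odot>\<^bsub>M\<^esub> x"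
    and r_distr: "\<And>a x y. a \<in> carrier A \<Longrightarrow> x \<in> carrier M \<Longrightarrow> y \<in> carrier M \<Longrightarrow>
      a \<odot>\<^bsub>M\<^esub> (x \<oplus>\<^bsub>M\<^esub> y) = a \<odot>\<^bsub>M\<^esub> x \<oplus>\<^bsub>M\<^esub> a \<odot>\<^bsub>M\<^esub> y"
    and smult_assoc: "\<And>a b x. a \<in> carrier A \<Longrightarrow> b \<in> carrier A \<Longrightarrow> x \<in> carrier M \<Longrightarrow>
      (a \<otimes> b) \<odot>\<^bsub>M\<^esub> x = a \<odot>\<^bsub>M\<^esub> (b \<odot>\<^bsub>M\<^esub> x)"
    and one: "\<And>x. x \<in> carrier M \<Longrightarrow> \<one> \<odot>\<^bsub>M\<^esub> x = x"
  shows "left_module A M"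
proof -
  interpret R: ring A by fact
  \<comment> \<open>The negative of \<open>x\<close> is (-1) x. The assumption
    \<open>zero_smult\<close> takes the place of the existence of inverses, so that all axioms
    become closure conditions and equations.\<close>
  have inv: "\<exists>y\<in>carrier M. y \<oplus>\<^bsub>M\<^esub> x = \<zero>\<^bsub>M\<^esub>" if "x \<in> carrier M" for x
  proof
    show "(\<ominus> \<one>) \<odot>\<^bsub>M\<^esub> x \<in> carrier M"
      using that by (intro smult) auto
    show "(\<ominus> \<one>) \<odot>\<^bsub>M\<^esub> x \<oplus>\<^bsub>M\<^esub> x = \<zero>\<^bsub>M\<^esub>"
      using l_distr[OF R.a_inv_closed[OF R.one_closed] R.one_closed that] one[OF that]
        zero_smult[OF that] by (simp add: R.l_neg)
  qed
  have "abelian_group M"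
    by (rule abelian_groupI) (use zero add assoc comm add_zero inv in auto)
  then show ?thesis
    by (intro left_module.intro left_module_axioms.intro \<open>ring A\<close> smult l_distr r_distr
      smult_assoc one)
qed

text \<open>The axioms collected in \<open>left_moduleI\<close> are closure conditions and
  equations, and an injective map that respects the operations reflects equations.\<close>

lemma left_module_via_injection:
  assumes P: "left_module A P" and inj: "inj_on \<phi> (carrier E)"
    and c: "\<And>e. e \<in> carrier E \<Longrightarrow> \<phi> e \<in> carrier P"
    and zero: "\<zero>\<^bsub>E\<^esub> \<in> carrier E" "\<phi> \<zero>\<^bsub>E\<^esub> = \<zero>\<^bsub>P\<^esub>"
    and add: "\<And>x y. x \<in> carrier E \<Longrightarrow> y \<in> carrier E \<Longrightarrow>
      x \<oplus>\<^bsub>E\<^esub> y \<in> carrier E \<and> \<phi> (x \<oplus>\<^bsub>E\<^esub> y) = \<phi> x \<oplus>\<^bsub>P\<^esub> \<phi> y"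
    and smult: "\<And>a x. a \<in> carrier A \<Longrightarrow> x \<in> carrier E \<Longrightarrow>
      a \<odot>\<^bsub>E\<^esub> x \<in> carrier E \<and> \<phi> (a \<odot>\<^bsub>E\<^esub> x) = a \<odot>\<^bsub>P\<^esub> \<phi> x"
  shows "left_module A E"
proof -
  interpret P: left_module A P by fact
  note [simp] = c zero add smult
  show ?thesis
    by (rule left_moduleI[OF P.R.ring_axioms]; (simp; fail)?; rule inj_onD[OF inj])
      (simp_all add: P.M.a_ac P.smult_l_distr P.smult_r_distr P.smult_assoc1 P.smult_one
        P.smult_zero_left)
qed

text \<open>Dual to the previous transport: equations between elements of \<open>P\<close> push
  forward to their images.\<close>

lemma left_module_via_surjection:
  assumes P: "left_module A P" and surj: "p ` carrier P = carrier E"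
    and zero: "p \<zero>\<^bsub>P\<^esub> = \<zero>\<^bsub>E\<^esub>"
    and add: "\<And>x y. x \<in> carrier P \<Longrightarrow> y \<in> carrier P \<Longrightarrow> p (x \<oplus>\<^bsub>P\<^esub> y) = p x \<oplus>\<^bsub>E\<^esub> p y"
    and smult: "\<And>a x. a \<in> carrier A \<Longrightarrow> x \<in> carrier P \<Longrightarrow> p (a \<odot>\<^bsub>P\<^esub> x) = a \<odot>\<^bsub>E\<^esub> p x"
  shows "left_module A E"
proof -
  interpret P: left_module A P by fact
  note [simp] = surj[symmetric] zero[symmetric] add[symmetric] smult[symmetric] P.smult_closed
  show ?thesis
    by (rule left_moduleI[OF P.R.ring_axioms]) (auto simp: P.M.a_ac P.smult_l_distr P.smult_r_distr
      P.smult_assoc1 P.smult_one P.smult_zero_left)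
qed

lemma left_module_submodule:
  assumes "left_module A M" "Module.submodule N A M"
  shows "left_module A (M\<lparr>carrier := N\<rparr>)"
proof -
  interpret M: left_module A M by fact
  show ?thesis
    by (rule left_module_via_injection[OF assms(1), where \<phi> = id])
      (use M.submoduleD[OF assms(2)] in auto)
qed

lemma left_module_direct_sum:
  assumes "left_module A M" "left_module A N"
  shows "left_module A (direct_sum M N)"
proof -
  interpret M: left_module A M by fact
  interpret N: left_module A N by fact
  show ?thesis
    by (rule left_moduleI[OF M.R.ring_axioms])
      (auto simp: direct_sum_def M.smult_closed N.smult_closed M.M.a_ac N.M.a_ac M.smult_zero_left
        N.smult_zero_left M.smult_l_distr N.smult_l_distr M.smult_r_distr N.smult_r_distr
        M.smult_assoc1 N.smult_assoc1 M.smult_one N.smult_one)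
qed

lemma left_module_power_module:
  assumes "left_module A U"
  shows "left_module A (power_module U d)" (is "left_module A ?P")
proof -
  interpret U: left_module A U by fact
  have memD: "x i \<in> carrier U" if "x \<in> carrier ?P" "i < d" for x i
    using that PiE_mem[of x "{..<d}" "\<lambda>_. carrier U" i] by (simp add: power_module_def)
  have zero: "\<zero>\<^bsub>?P\<^esub> \<in> carrier ?P"
    by (simp add: power_module_def)
  have add: "x \<oplus>\<^bsub>?P\<^esub> y \<in> carrier ?P" if "x \<in> carrier ?P" "y \<in> carrier ?P" for x y
    using memD[OF that(1)] memD[OF that(2)] by (simp add: power_module_def)
  have smult: "a \<odot>\<^bsub>?P\<^esub> x \<in> carrier ?P" if "a \<in> carrier A" "x \<in> carrier ?P" for a x
    using that(1) memD[OF that(2)] by (simp add: power_module_def U.smult_closed)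
  have eqI: "x = y" if "x \<in> carrier ?P" "y \<in> carrier ?P" "\<And>i. i < d \<Longrightarrow> x i = y i" for x y
    using that by (intro PiE_ext[of x "{..<d}" "\<lambda>_. carrier U"]) (simp_all add: power_module_def)
  have [simp]: "(x \<oplus>\<^bsub>?P\<^esub> y) i = x i \<oplus>\<^bsub>U\<^esub> y i" "\<zero>\<^bsub>?P\<^esub> i = \<zero>\<^bsub>U\<^esub>" "(a \<odot>\<^bsub>?P\<^esub> x) i = a \<odot>\<^bsub>U\<^esub> x i"
    if "i < d" for x y a i
    using that by (simp_all add: power_module_def)
  note [simp] = memD zero add smult
  show ?thesis
    by (rule left_moduleI[OF U.R.ring_axioms]; (simp; fail)?; rule eqI)
      (simp_all add: U.M.a_ac U.smult_zero_left U.smult_l_distr U.smult_r_distr U.smult_assoc1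
        U.smult_one)
qed

section \<open>Homomorphisms of left modules\<close>

lemma module_homI:
  assumes "\<And>x. x \<in> carrier M \<Longrightarrow> f x \<in> carrier N"
    and "\<And>x y. x \<in> carrier M \<Longrightarrow> y \<in> carrier M \<Longrightarrow> f (x \<oplus>\<^bsub>M\<^esub> y) = f x \<oplus>\<^bsub>N\<^esub> f y"
    and "\<And>a x. a \<in> carrier A \<Longrightarrow> x \<in> carrier M \<Longrightarrow> f (a \<odot>\<^bsub>M\<^esub> x) = a \<odot>\<^bsub>N\<^esub> f x"
  shows "f \<in> module_hom A M N"
  using assms by (auto simp: module_hom_def)

lemma module_hom_in_carrier:
  "f \<in> module_hom A M N \<Longrightarrow> x \<in> carrier M \<Longrightarrow> f x \<in> carrier N"
  using module_hom_closed by blast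

lemma module_hom_comp:
  assumes "left_module A L" "f \<in> module_hom A L M" "g \<in> module_hom A M N"
  shows "g \<circ> f \<in> module_hom A L N"
  using assms by (intro module_homI)
    (auto simp: module_hom_in_carrier module_hom_add module_hom_smult)

text \<open>The zero of \<open>M\<close> is the scalar 0 times itself, and \<open>f\<close> commutes
  with scalars.\<close>

lemma module_hom_zero:
  assumes "left_module A M" "left_module A N" "f \<in> module_hom A M N"
  shows "f \<zero>\<^bsub>M\<^esub> = \<zero>\<^bsub>N\<^esub>"
proof -
  interpret M: left_module A M by fact
  interpret N: left_module A N by fact
  show ?thesis
    using module_hom_smult[OF assms(3) M.R.zero_closed M.M.zero_closed]
      module_hom_in_carrier[OF assms(3) M.M.zero_closed]
    by (simp add: M.smult_zero_left N.smult_zero_left)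
qed

lemma module_hom_minus:
  assumes "left_module A M" "left_module A N" "f \<in> module_hom A M N"
    and "x \<in> carrier M" "y \<in> carrier M"
  shows "f (x \<ominus>\<^bsub>M\<^esub> y) = f x \<ominus>\<^bsub>N\<^esub> f y"
proof -
  interpret M: left_module A M by fact
  interpret N: left_module A N by fact
  have "f (\<ominus>\<^bsub>M\<^esub> y) = \<ominus>\<^bsub>N\<^esub> f y"
    using module_hom_smult[OF assms(3), of "\<ominus>\<^bsub>A\<^esub> \<one>\<^bsub>A\<^esub>" y] assms
    by (simp add: M.minus_one_smult N.minus_one_smult module_hom_in_carrier)
  then show ?thesis
    using assms by (simp add: a_minus_def module_hom_add)
qed

lemma submodule_image:
  assumes "left_module A M" "left_module A N" "f \<in> module_hom A M N" "Module.submodule L A M"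
  shows "Module.submodule (f ` L) A N"
proof -
  interpret M: left_module A M by fact
  interpret N: left_module A N by fact
  note L = M.submoduleD[OF assms(4)]
  show ?thesis
  proof (rule N.submoduleI)
    show "f ` L \<subseteq> carrier N" using L(1) module_hom_in_carrier[OF assms(3)] by blast
    show "\<zero>\<^bsub>N\<^esub> \<in> f ` L" using L(2) module_hom_zero[OF assms(1-3)] by force
    fix x y assume "x \<in> f ` L" "y \<in> f ` L"
    then obtain u v where "u \<in> L" "v \<in> L" "x = f u" "y = f v" by blast
    then show "x \<oplus>\<^bsub>N\<^esub> y \<in> f ` L"
      using L(1,3) module_hom_add[OF assms(3), of u v] by (simp add: subsetD image_eqI[of _ f "u \<oplus>\<^bsub>M\<^esub> v"])
  next
    fix a x assume "a \<in> carrier A" "x \<in> f ` L"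
    then obtain u where "a \<in> carrier A" "u \<in> L" "x = f u" by blast
    then show "a \<odot>\<^bsub>N\<^esub> x \<in> f ` L"
      using L(1,4) module_hom_smult[OF assms(3), of a u] by (simp add: subsetD image_eqI[of _ f "a \<odot>\<^bsub>M\<^esub> u"])
  qed
qed

lemma submodule_preimage:
  assumes "left_module A M" "left_module A N" "f \<in> module_hom A M N" "Module.submodule L A N"
  shows "Module.submodule {x \<in> carrier M. f x \<in> L} A M"
proof -
  interpret M: left_module A M by fact
  interpret N: left_module A N by fact
  note L = N.submoduleD[OF assms(4)]
  show ?thesis
    using L module_hom_zero[OF assms(1-3)] 
    by (intro M.submoduleI)
      (auto simp: module_hom_add[OF assms(3)] module_hom_smult[OF assms(3)] M.smult_closed)
qed

lemma module_iso_sym: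
  assumes "left_module A M" "f \<in> module_iso A M N"
  shows "inv_into (carrier M) f \<in> module_iso A N M"
proof -
  interpret M: left_module A M by fact
  have f: "f \<in> module_hom A M N" and b: "bij_betw f (carrier M) (carrier N)"
    using assms(2) by (auto simp: module_iso_def)
  let ?g = "inv_into (carrier M) f"
  have g: "?g y \<in> carrier M" "f (?g y) = y" if "y \<in> carrier N" for y
    using that b by (auto simp: bij_betw_def inv_into_into f_inv_into_f)
  have gI: "?g (f x) = x" if "x \<in> carrier M" for x
    using that b by (auto simp: bij_betw_def)
  have "?g (x \<oplus>\<^bsub>N\<^esub> y) = ?g x \<oplus>\<^bsub>M\<^esub> ?g y" if "x \<in> carrier N" "y \<in> carrier N" for x y
    using that g module_hom_add[OF f, of "?g x" "?g y"] gI[of "?g x \<oplus>\<^bsub>M\<^esub> ?g y"] by simp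
  moreover have "?g (a \<odot>\<^bsub>N\<^esub> x) = a \<odot>\<^bsub>M\<^esub> ?g x" if "a \<in> carrier A" "x \<in> carrier N" for a x
    using that g module_hom_smult[OF f, of a "?g x"] gI[of "a \<odot>\<^bsub>M\<^esub> ?g x"]
    by (simp add: M.smult_closed)
  ultimately have "?g \<in> module_hom A N M"
    using g by (intro module_homI) auto
  then show ?thesis
    using bij_betw_inv_into[OF b] by (simp add: module_iso_def)
qed

section \<open>Quotient modules\<close>

text \<open>Describes M / N by a surjection with kernel \<open>N\<close> instead of by cosets. Thus
  \<open>M\<close> itself for N = 0, coset modules, and iterated coset modules with elements in sets
  of sets can all be handled alike.\<close>

definition is_quotient ::
    "('k, 'a) module \<Rightarrow> ('a, 'm) module \<Rightarrow> 'm set \<Rightarrow> ('a, 'q) module \<Rightarrow> ('m \<Rightarrow> 'q) \<Rightarrow> bool" where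
  "is_quotient A M N Q p \<longleftrightarrow> left_module A M \<and> left_module A Q \<and> p \<in> module_hom A M Q \<and>
     p ` carrier M = carrier Q \<and> N = {x \<in> carrier M. p x = \<zero>\<^bsub>Q\<^esub>}"

lemma is_quotientD:
  assumes "is_quotient A M N Q p"
  shows "left_module A M" "left_module A Q" "p \<in> module_hom A M Q" "p ` carrier M = carrier Q"
    "N = {x \<in> carrier M. p x = \<zero>\<^bsub>Q\<^esub>}"
  using assms unfolding is_quotient_def by auto

lemma is_quotient_submodule:
  assumes "is_quotient A M N Q p" shows "Module.submodule N A M"
  using submodule_preimage[OF is_quotientD(1-3)[OF assms]]
    left_module.submodule_zero[OF is_quotientD(2)[OF assms]] is_quotientD(5)[OF assms]
  by fastforce

lemma is_quotient_eq_iff: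
  assumes "is_quotient A M N Q p" "x \<in> carrier M" "y \<in> carrier M"
  shows "p x = p y \<longleftrightarrow> x \<ominus>\<^bsub>M\<^esub> y \<in> N"
proof -
  note q = is_quotientD[OF assms(1)]
  interpret M: left_module A M by (rule q(1))
  interpret Q: left_module A Q by (rule q(2))
  show ?thesis
    unfolding q(5) using assms(2,3) module_hom_in_carrier[OF q(3)]
    by (simp add: module_hom_minus[OF q(1-3)] Q.minus_eq_zero_iff)
qed

lemma is_quotient_lift:
  assumes "is_quotient A M N Q p"
  obtains s where "\<And>z. z \<in> carrier Q \<Longrightarrow> s z \<in> carrier M" "\<And>z. z \<in> carrier Q \<Longrightarrow> p (s z) = z"
  using is_quotientD(4)[OF assms] that[of "inv_into (carrier M) p"]
  by (metis f_inv_into_f inv_into_into)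

lemma is_quotient_id:
  assumes "left_module A M"
  shows "is_quotient A M {\<zero>\<^bsub>M\<^esub>} M (\<lambda>x. x)"
proof -
  interpret M: left_module A M by fact
  show ?thesis
    using assms by (auto simp: is_quotient_def module_hom_def)
qed

lemma (in left_module) abelian_subgroup_submodule:
  assumes "Module.submodule N R M" shows "abelian_subgroup N M"
  using assms by (intro abelian_subgroupI3 additive_subgroupI M.abelian_group_axioms)
    (rule Module.submodule.axioms(1))

lemma (in left_module) a_r_coset_eq_iff:
  assumes "Module.submodule N R M" "x \<in> carrier M" "y \<in> carrier M"
  shows "N +>\<^bsub>M\<^esub> x = N +>\<^bsub>M\<^esub> y \<longleftrightarrow> x \<ominus>\<^bsub>M\<^esub> y \<in> N"
proof -
  interpret N: abelian_subgroup N M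
    by (rule abelian_subgroup_submodule[OF assms(1)])
  show ?thesis
    using N.a_rcos_module[OF assms(3,2)] N.a_rcos_self[OF assms(2)]
      M.a_repr_independence[OF _ assms(3) N.a_subgroup] by (metis a_minus_def)
qed

text \<open>Scalar multiplication in \<open>quotient_module\<close> and the action of
  \<open>projection_functor\<close> on homomorphisms are unions over a coset. Such a union may be
  evaluated at one representative once its members agree.\<close>

lemma (in left_module) UN_a_r_coset:
  assumes N: "Module.submodule N R M" and x: "x \<in> carrier M"
    and const: "\<And>y. y \<in> carrier M \<Longrightarrow> y \<ominus>\<^bsub>M\<^esub> x \<in> N \<Longrightarrow> F y = F x"
  shows "(\<Union>y \<in> N +>\<^bsub>M\<^esub> x. F y) = F x"
proof -
  interpret N: abelian_subgroup N M
    by (rule abelian_subgroup_submodule[OF N])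
  have "F y = F x" if "y \<in> N +>\<^bsub>M\<^esub> x" for y
    using that N.a_elemrcos_carrier[OF x that] N.a_rcos_module[OF x] const
    by (simp add: a_minus_def)
  then have "(\<Union>y \<in> N +>\<^bsub>M\<^esub> x. F y) = (\<Union>y \<in> N +>\<^bsub>M\<^esub> x. F x)"
    by (intro SUP_cong refl)
  also have "\<dots> = F x"
    using N.a_rcos_self[OF x] by (intro UN_constant_eq) auto
  finally show ?thesis .
qed

lemma is_quotient_quotient_module:
  assumes "left_module A M" "Module.submodule N A M"
  shows "is_quotient A M N (quotient_module M N) (\<lambda>x. N +>\<^bsub>M\<^esub> x)"
    (is "is_quotient A M N ?Q ?p")
proof -
  interpret M: left_module A M by fact
  interpret N: abelian_subgroup N M
    by (rule M.abelian_subgroup_submodule[OF assms(2)])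
  note N = M.submoduleD[OF assms(2)]
  note eq_iff = M.a_r_coset_eq_iff[OF assms(2)]
  have surj: "?p ` carrier M = carrier ?Q"
    by (auto simp: quotient_module_def A_RCOSETS_def')
  have zero: "?p \<zero>\<^bsub>M\<^esub> = \<zero>\<^bsub>?Q\<^esub>"
    using N(1) by (simp add: quotient_module_def)
  have add: "?p (x \<oplus>\<^bsub>M\<^esub> y) = ?p x \<oplus>\<^bsub>?Q\<^esub> ?p y" if "x \<in> carrier M" "y \<in> carrier M" for x y
    using that N.a_rcos_sum by (simp add: quotient_module_def)
  have smult: "?p (a \<odot>\<^bsub>M\<^esub> x) = a \<odot>\<^bsub>?Q\<^esub> ?p x" if a: "a \<in> carrier A" and x: "x \<in> carrier M" for a x
  proof -
    have "?p (a \<odot>\<^bsub>M\<^esub> y) = ?p (a \<odot>\<^bsub>M\<^esub> x)" if "y \<in> carrier M" "y \<ominus>\<^bsub>M\<^esub> x \<in> N" for y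
      using eq_iff[of "a \<odot>\<^bsub>M\<^esub> y" "a \<odot>\<^bsub>M\<^esub> x"] a x that N(4)
      by (simp add: M.smult_closed flip: M.smult_diff)
    then show ?thesis
      using M.UN_a_r_coset[OF assms(2) x, of "\<lambda>y. ?p (a \<odot>\<^bsub>M\<^esub> y)"]
      by (simp add: quotient_module_def)
  qed
  have "left_module A ?Q"
    by (rule left_module_via_surjection[OF assms(1) surj zero add smult])
  moreover have "?p \<in> module_hom A M ?Q"
    using surj add smult by (intro module_homI) auto
  moreover have "N = {x \<in> carrier M. ?p x = \<zero>\<^bsub>?Q\<^esub>}"
  proof -
    have "?p x = ?p \<zero>\<^bsub>M\<^esub> \<longleftrightarrow> x \<in> N" if "x \<in> carrier M" for x
      using eq_iff[OF that M.M.zero_closed] M.minus_add_cancel[OF that M.M.zero_closed] that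
      by simp
    then show ?thesis
      unfolding zero[symmetric] using N(1) by blast
  qed
  ultimately show ?thesis
    using assms(1) surj by (simp add: is_quotient_def)
qed

lemma a_kernel_eq: "a_kernel M N f = {x \<in> carrier M. f x = \<zero>\<^bsub>N\<^esub>}"
  by (simp add: a_kernel_def kernel_def)

text \<open>With a set-theoretic section \<open>s\<close> of \<open>p\<close>, the map
  \<open>r\<close> after \<open>s\<close> does not depend on the choice, since \<open>p\<close> and
  \<open>r\<close> identify the same pairs, those with difference in \<open>N\<close>. The
  compatibility of \<open>h\<close> with \<open>p\<close> and \<open>r\<close> is what later yields
  naturality.\<close>

lemma is_quotient_unique:
  assumes q: "is_quotient A M N Q p" and r: "is_quotient A M N R r"
  obtains h where "h \<in> module_iso A Q R" "\<And>x. x \<in> carrier M \<Longrightarrow> h (p x) = r x"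
proof -
  note q' = is_quotientD[OF q] and r' = is_quotientD[OF r]
  interpret M: left_module A M by (rule q'(1))
  obtain s where s: "\<And>z. z \<in> carrier Q \<Longrightarrow> s z \<in> carrier M" "\<And>z. z \<in> carrier Q \<Longrightarrow> p (s z) = z"
    using is_quotient_lift[OF q] by blast
  define h where "h z = r (s z)" for z
  have pr: "p x = p y \<longleftrightarrow> r x = r y" if "x \<in> carrier M" "y \<in> carrier M" for x y
    using is_quotient_eq_iff[OF q that] is_quotient_eq_iff[OF r that] by simp
  have h: "h (p x) = r x" if "x \<in> carrier M" for x
    using pr[of "s (p x)" x] s that module_hom_in_carrier[OF q'(3) that] by (simp add: h_def)
  have "h (x \<oplus>\<^bsub>Q\<^esub> y) = h x \<oplus>\<^bsub>R\<^esub> h y" if "x \<in> carrier Q" "y \<in> carrier Q" for x y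
    using h[of "s x \<oplus>\<^bsub>M\<^esub> s y"] s[OF that(1)] s[OF that(2)]
      module_hom_add[OF q'(3), of "s x" "s y"] module_hom_add[OF r'(3), of "s x" "s y"]
    by (simp add: h_def)
  moreover have "h (a \<odot>\<^bsub>Q\<^esub> x) = a \<odot>\<^bsub>R\<^esub> h x" if "a \<in> carrier A" "x \<in> carrier Q" for a x
    using h[of "a \<odot>\<^bsub>M\<^esub> s x"] s[OF that(2)] that(1)
      module_hom_smult[OF q'(3), of a "s x"] module_hom_smult[OF r'(3), of a "s x"]
    by (simp add: M.smult_closed h_def)
  ultimately have "h \<in> module_hom A Q R"
    using s(1) module_hom_in_carrier[OF r'(3)] by (intro module_homI) (simp_all add: h_def)
  moreover have "inj_on h (carrier Q)"
    using s pr by (intro inj_onI) (metis h_def)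
  moreover have "h ` carrier Q = carrier R"
    unfolding q'(4)[symmetric] r'(4)[symmetric] image_image by (rule image_cong[OF refl h])
  ultimately show thesis
    using that h by (simp add: module_iso_def bij_betw_def)
qed

lemma is_quotient_comp:
  assumes "is_quotient A M N Q p" "is_quotient A Q L R r"
  shows "is_quotient A M {x \<in> carrier M. p x \<in> L} R (\<lambda>x. r (p x))"
proof -
  note q = is_quotientD[OF assms(1)] and r = is_quotientD[OF assms(2)]
  have "(\<lambda>x. r (p x)) \<in> module_hom A M R"
    using module_hom_comp[OF q(1,3) r(3)] by (simp add: comp_def)
  moreover have "(\<lambda>x. r (p x)) ` carrier M = carrier R"
    using q(4) r(4) by (simp flip: image_image)
  moreover have "{x \<in> carrier M. p x \<in> L} = {x \<in> carrier M. r (p x) = \<zero>\<^bsub>R\<^esub>}"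
    unfolding r(5) using module_hom_in_carrier[OF q(3)] by blast
  ultimately show ?thesis
    using q(1) r(2) by (simp add: is_quotient_def)
qed

section \<open>Homomorphisms modulo a submodule\<close>

text \<open>A representative of a homomorphism X \<rightarrow> M / N: a map of sets into
  \<open>M\<close> that is additive and linear only up to errors in \<open>N\<close>. Distinct maps
  may represent the same homomorphism.\<close>

definition hom_mod ::
    "('k, 'a) module \<Rightarrow> ('a, 'x) module \<Rightarrow> ('a, 'm) module \<Rightarrow> 'm set \<Rightarrow> ('x \<Rightarrow> 'm) set" where
  "hom_mod A X M N = {f \<in> carrier X \<rightarrow> carrier M.
     (\<forall>x \<in> carrier X. \<forall>y \<in> carrier X. f (x \<oplus>\<^bsub>X\<^esub> y) \<ominus>\<^bsub>M\<^esub> (f x \<oplus>\<^bsub>M\<^esub> f y) \<in> N) \<and>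
     (\<forall>a \<in> carrier A. \<forall>x \<in> carrier X. f (a \<odot>\<^bsub>X\<^esub> x) \<ominus>\<^bsub>M\<^esub> a \<odot>\<^bsub>M\<^esub> f x \<in> N)}"

lemma hom_mod_in_carrier: "f \<in> hom_mod A X M N \<Longrightarrow> x \<in> carrier X \<Longrightarrow> f x \<in> carrier M"
  by (auto simp: hom_mod_def)

lemma hom_mod_mono: "N \<subseteq> N' \<Longrightarrow> hom_mod A X M N \<subseteq> hom_mod A X M N'"
  by (auto simp: hom_mod_def)

lemma hom_mod_iff:
  assumes X: "left_module A X" and q: "is_quotient A M N Q p"
    and f: "\<And>x. x \<in> carrier X \<Longrightarrow> f x \<in> carrier M"
  shows "f \<in> hom_mod A X M N \<longleftrightarrow> (\<lambda>x. p (f x)) \<in> module_hom A X Q"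
proof -
  note q' = is_quotientD[OF q]
  interpret M: left_module A M by (rule q'(1))
  interpret X: left_module A X by fact
  have "f (x \<oplus>\<^bsub>X\<^esub> y) \<ominus>\<^bsub>M\<^esub> (f x \<oplus>\<^bsub>M\<^esub> f y) \<in> N \<longleftrightarrow> p (f (x \<oplus>\<^bsub>X\<^esub> y)) = p (f x) \<oplus>\<^bsub>Q\<^esub> p (f y)"
    if "x \<in> carrier X" "y \<in> carrier X" for x y
    using is_quotient_eq_iff[OF q, of "f (x \<oplus>\<^bsub>X\<^esub> y)" "f x \<oplus>\<^bsub>M\<^esub> f y"] that f
      module_hom_add[OF q'(3), of "f x" "f y"] by simp
  moreover have "f (a \<odot>\<^bsub>X\<^esub> x) \<ominus>\<^bsub>M\<^esub> a \<odot>\<^bsub>M\<^esub> f x \<in> N \<longleftrightarrow> p (f (a \<odot>\<^bsub>X\<^esub> x)) = a \<odot>\<^bsub>Q\<^esub> p (f x)"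
    if "a \<in> carrier A" "x \<in> carrier X" for a x
    using is_quotient_eq_iff[OF q, of "f (a \<odot>\<^bsub>X\<^esub> x)" "a \<odot>\<^bsub>M\<^esub> f x"] that f
      module_hom_smult[OF q'(3), of a "f x"] by (simp add: X.smult_closed M.smult_closed)
  ultimately show ?thesis
    using f module_hom_in_carrier[OF q'(3)] by (auto simp: hom_mod_def module_hom_def)
qed

text \<open>Composing \<open>h\<close> with a set-theoretic section of \<open>p\<close> suffices,
  because linearity is asked for only modulo \<open>N\<close>.\<close>

lemma hom_mod_lift:
  assumes X: "left_module A X" and q: "is_quotient A M N Q p" and h: "h \<in> module_hom A X Q"
  obtains f where "f \<in> hom_mod A X M N" "\<And>x. x \<in> carrier X \<Longrightarrow> p (f x) = h x"
proof -
  obtain s where s: "\<And>z. z \<in> carrier Q \<Longrightarrow> s z \<in> carrier M" "\<And>z. z \<in> carrier Q \<Longrightarrow> p (s z) = z"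
    using is_quotient_lift[OF q] by blast
  have "(\<lambda>x. p (s (h x))) \<in> module_hom A X Q"
  proof -
    interpret X: left_module A X by fact
    have "p (s (h x)) = h x" if "x \<in> carrier X" for x
      using that module_hom_in_carrier[OF h] s by blast
    then show ?thesis
      using module_hom_in_carrier[OF h] module_hom_add[OF h] module_hom_smult[OF h]
      by (intro module_homI) (metis X.smult_closed X.M.add.m_closed)+
  qed
  then have "(\<lambda>x. s (h x)) \<in> hom_mod A X M N"
    using s module_hom_in_carrier[OF h] by (subst hom_mod_iff[OF X q]) auto
  then show thesis
    using that s module_hom_in_carrier[OF h] by auto
qed

lemma hom_mod_zero:
  assumes "left_module A X" "left_module A M"
  shows "hom_mod A X M {\<zero>\<^bsub>M\<^esub>} = module_hom A X M"
  using hom_mod_iff[OF assms(1) is_quotient_id[OF assms(2)]] hom_mod_in_carrier[of _ A X M]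
    module_hom_in_carrier[of _ A X M] by blast

text \<open>
  For a submodule \<open>N\<close> of \<open>M\<close>, this is the preimage in \<open>M\<close> of the trace of \<open>U\<close> in \<open>M / N\<close>, hence
  the kernel of \<open>M \<rightarrow> P\<^sub>U(M / N)\<close>. Working with homomorphisms modulo \<open>N\<close> instead of with
  \<open>M / N\<close> keeps iterated projections inside the lattice of submodules of \<open>M\<close>.
\<close>

definition trace_closure ::
    "('k, 'a) module \<Rightarrow> ('a, 'u) module \<Rightarrow> ('a, 'm) module \<Rightarrow> 'm set \<Rightarrow> 'm set" where
  "trace_closure A U M N = \<Inter>{L. Module.submodule L A M \<and> N \<subseteq> L \<and>
     (\<forall>f \<in> hom_mod A U M N. f ` carrier U \<subseteq> L)}"

lemma trace_closure_least:
  assumes "Module.submodule L A M" "N \<subseteq> L"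
    and "\<And>f u. f \<in> hom_mod A U M N \<Longrightarrow> u \<in> carrier U \<Longrightarrow> f u \<in> L"
  shows "trace_closure A U M N \<subseteq> L"
  using assms unfolding trace_closure_def by blast

lemma subset_trace_closure: "N \<subseteq> trace_closure A U M N"
  unfolding trace_closure_def by blast

lemma hom_mod_in_trace_closure:
  "f \<in> hom_mod A U M N \<Longrightarrow> u \<in> carrier U \<Longrightarrow> f u \<in> trace_closure A U M N"
  unfolding trace_closure_def by blast

lemma submodule_trace_closure:
  assumes "left_module A M" "N \<subseteq> carrier M"
  shows "Module.submodule (trace_closure A U M N) A M"
proof -
  interpret M: left_module A M by fact
  show ?thesis
    unfolding trace_closure_def
  proof (rule M.submodule_Inter)
    have "f ` carrier U \<subseteq> carrier M" if "f \<in> hom_mod A U M N" for f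
      using hom_mod_in_carrier[OF that] by blast
    then show "{L. Module.submodule L A M \<and> N \<subseteq> L \<and>
        (\<forall>f \<in> hom_mod A U M N. f ` carrier U \<subseteq> L)} \<noteq> {}"
      using assms(2) M.submodule_carrier by blast
  qed simp
qed

lemma trace_closure_mono:
  assumes "left_module A M" "N' \<subseteq> carrier M" "N \<subseteq> N'"
  shows "trace_closure A U M N \<subseteq> trace_closure A U M N'"
  using assms hom_mod_mono[OF assms(3), of A U M] subset_trace_closure[of N' A U M]
  by (intro trace_closure_least submodule_trace_closure hom_mod_in_trace_closure) auto

text \<open>This links closures in \<open>M\<close> with traces in the quotient, and so gives the
  kernel of a further projection. Both inclusions compare generators: maps modulo \<open>N\<close>
  into \<open>M\<close> and homomorphisms into \<open>Q\<close> correspond to each other under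
  \<open>p\<close>.\<close>

lemma trace_closure_preimage:
  assumes U: "left_module A U" and q: "is_quotient A M N Q p"
  shows "trace_closure A U M N = {x \<in> carrier M. p x \<in> trace_closure A U Q {\<zero>\<^bsub>Q\<^esub>}}"
proof
  note q' = is_quotientD[OF q]
  interpret M: left_module A M by (rule q'(1))
  interpret Q: left_module A Q by (rule q'(2))
  note N = M.submoduleD[OF is_quotient_submodule[OF q]]
  have LM: "Module.submodule (trace_closure A U M N) A M"
    by (rule submodule_trace_closure[OF q'(1) N(1)])
  have LQ: "Module.submodule (trace_closure A U Q {\<zero>\<^bsub>Q\<^esub>}) A Q"
    by (rule submodule_trace_closure[OF q'(2)]) simp
  show "trace_closure A U M N \<subseteq> {x \<in> carrier M. p x \<in> trace_closure A U Q {\<zero>\<^bsub>Q\<^esub>}}"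
  proof (rule trace_closure_least)
    show "Module.submodule {x \<in> carrier M. p x \<in> trace_closure A U Q {\<zero>\<^bsub>Q\<^esub>}} A M"
      by (rule submodule_preimage[OF q'(1-3) LQ])
    show "N \<subseteq> {x \<in> carrier M. p x \<in> trace_closure A U Q {\<zero>\<^bsub>Q\<^esub>}}"
      using subset_trace_closure[of "{\<zero>\<^bsub>Q\<^esub>}" A U Q] unfolding q'(5) by auto
    fix f u assume f: "f \<in> hom_mod A U M N" and u: "u \<in> carrier U"
    have "(\<lambda>u. p (f u)) \<in> hom_mod A U Q {\<zero>\<^bsub>Q\<^esub>}"
      unfolding hom_mod_zero[OF U q'(2)]
      using f by (subst hom_mod_iff[OF U q, symmetric]) (auto simp: hom_mod_in_carrier)
    from hom_mod_in_trace_closure[OF this u]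
    show "f u \<in> {x \<in> carrier M. p x \<in> trace_closure A U Q {\<zero>\<^bsub>Q\<^esub>}}"
      using hom_mod_in_carrier[OF f u] by simp
  qed
  \<comment> \<open>Each homomorphism from \<open>U\<close> to \<open>Q\<close> comes from a map
    modulo \<open>N\<close>, so the image of the closure contains all generators of the
    trace.\<close>
  have "trace_closure A U Q {\<zero>\<^bsub>Q\<^esub>} \<subseteq> p ` trace_closure A U M N"
  proof (rule trace_closure_least)
    show im: "Module.submodule (p ` trace_closure A U M N) A Q"
      by (rule submodule_image[OF q'(1-3) LM])
    show "{\<zero>\<^bsub>Q\<^esub>} \<subseteq> p ` trace_closure A U M N"
      using Q.submoduleD(2)[OF im] by simp
    fix h u assume h: "h \<in> hom_mod A U Q {\<zero>\<^bsub>Q\<^esub>}" and u: "u \<in> carrier U"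
    then obtain f where "f \<in> hom_mod A U M N" "p (f u) = h u"
      using hom_mod_lift[OF U q, of h] unfolding hom_mod_zero[OF U q'(2)] by metis
    then show "h u \<in> p ` trace_closure A U M N"
      using hom_mod_in_trace_closure[OF _ u] by force
  qed
  then show "{x \<in> carrier M. p x \<in> trace_closure A U Q {\<zero>\<^bsub>Q\<^esub>}} \<subseteq> trace_closure A U M N"
  proof (intro subsetI, elim CollectE conjE)
    fix x assume *: "trace_closure A U Q {\<zero>\<^bsub>Q\<^esub>} \<subseteq> p ` trace_closure A U M N"
      and x: "x \<in> carrier M" "p x \<in> trace_closure A U Q {\<zero>\<^bsub>Q\<^esub>}"
    \<comment> \<open>The elements \<open>x\<close> and \<open>y\<close> agree only modulo
      \<open>N\<close>, but \<open>N\<close> is part of the closure.\<close>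
    then obtain y where y: "y \<in> trace_closure A U M N" "p x = p y" by blast
    note L = M.submoduleD[OF LM]
    have "y \<in> carrier M" using y L(1) by blast
    then have "x \<ominus>\<^bsub>M\<^esub> y \<in> trace_closure A U M N"
      using is_quotient_eq_iff[OF q] x y subset_trace_closure[of N] by blast
    then show "x \<in> trace_closure A U M N"
      using L(3)[OF _ y(1)] M.minus_add_cancel[OF x(1) \<open>y \<in> carrier M\<close>] by metis
  qed
qed

text \<open>Composition with \<open>f\<close> turns homomorphisms from \<open>U\<close> to
  \<open>M\<close> into homomorphisms from \<open>U\<close> to \<open>N\<close>. This makes the
  induced map on quotients well defined.\<close>

lemma trace_closure_image:
  assumes "left_module A U" "left_module A M" "left_module A N" "f \<in> module_hom A M N"
    and "x \<in> trace_closure A U M {\<zero>\<^bsub>M\<^esub>}"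
  shows "f x \<in> trace_closure A U N {\<zero>\<^bsub>N\<^esub>}"
proof -
  interpret N: left_module A N by fact
  let ?L = "{x \<in> carrier M. f x \<in> trace_closure A U N {\<zero>\<^bsub>N\<^esub>}}"
  have "trace_closure A U M {\<zero>\<^bsub>M\<^esub>} \<subseteq> ?L"
  proof (rule trace_closure_least)
    show L: "Module.submodule ?L A M"
      by (rule submodule_preimage[OF assms(2-4) submodule_trace_closure[OF assms(3)]]) simp
    show "{\<zero>\<^bsub>M\<^esub>} \<subseteq> ?L"
      using left_module.submoduleD(2)[OF assms(2) L] by simp
    fix h u assume h: "h \<in> hom_mod A U M {\<zero>\<^bsub>M\<^esub>}" and u: "u \<in> carrier U"
    have "f \<circ> h \<in> hom_mod A U N {\<zero>\<^bsub>N\<^esub>}"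
      using h assms(1-4) by (simp add: hom_mod_zero module_hom_comp)
    from hom_mod_in_trace_closure[OF this u]
    show "h u \<in> ?L"
      using hom_mod_in_carrier[OF h u] by simp
  qed
  then show ?thesis using assms(5) by blast
qed

section \<open>Finite dimensional modules\<close>

lemma underlying_space_simps [simp]:
  "carrier (underlying_space A M) = carrier M"
  "add (underlying_space A M) = add M"
  "zero (underlying_space A M) = zero M"
  "c \<odot>\<^bsub>underlying_space A M\<^esub> x = (c \<odot>\<^bsub>A\<^esub> \<one>\<^bsub>A\<^esub>) \<odot>\<^bsub>M\<^esub> x"
  by (simp_all add: underlying_space_def)

text \<open>Restriction of scalars along c \<mapsto> c 1, which is additive, and multiplicative by
  \<open>smult_assoc2\<close>.\<close>

lemma vectorspace_underlying_space:
  assumes "fd_algebra K A" "left_module A M"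
  shows "vectorspace K (underlying_space A M)"
proof -
  interpret A: fd_algebra K A by fact
  interpret M: left_module A M by fact
  have [simp]: "c \<odot>\<^bsub>A\<^esub> \<one>\<^bsub>A\<^esub> \<in> carrier A" if "c \<in> carrier K" for c
    using that by simp
  have "(c \<otimes>\<^bsub>K\<^esub> d) \<odot>\<^bsub>A\<^esub> \<one>\<^bsub>A\<^esub> = (c \<odot>\<^bsub>A\<^esub> \<one>\<^bsub>A\<^esub>) \<otimes>\<^bsub>A\<^esub> (d \<odot>\<^bsub>A\<^esub> \<one>\<^bsub>A\<^esub>)"
    if "c \<in> carrier K" "d \<in> carrier K" for c d
    using that A.smult_assoc2[of c "\<one>\<^bsub>A\<^esub>" "d \<odot>\<^bsub>A\<^esub> \<one>\<^bsub>A\<^esub>"] by (simp add: A.smult_assoc1)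
  moreover have "(c \<oplus>\<^bsub>K\<^esub> d) \<odot>\<^bsub>A\<^esub> \<one>\<^bsub>A\<^esub> = (c \<odot>\<^bsub>A\<^esub> \<one>\<^bsub>A\<^esub>) \<oplus>\<^bsub>A\<^esub> (d \<odot>\<^bsub>A\<^esub> \<one>\<^bsub>A\<^esub>)"
    if "c \<in> carrier K" "d \<in> carrier K" for c d
    using that by (simp add: A.smult_l_distr)
  moreover have "abelian_group (underlying_space A M)"
    by (rule abelian_groupI) (auto simp: M.M.a_ac intro: bexI[of _ "\<ominus>\<^bsub>M\<^esub> x" for x] M.M.l_neg)
  moreover have "cring K"
    using A.field_axioms by (simp add: field_def domain_def)
  ultimately have "module K (underlying_space A M)"
    by (intro moduleI) (simp_all add: M.smult_closed M.smult_l_distr M.smult_r_distr M.smult_assoc1 M.smult_one)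
  then show ?thesis
    using A.field_axioms by (simp add: vectorspace_def)
qed

text \<open>Choose a member of the family that contains a linearly independent set \<open>B\<close>
  of largest possible size; the dimension of \<open>M\<close> bounds these sizes. A vector of a
  larger member outside \<open>N\<close> is not in the span of \<open>B\<close>, which lies in
  \<open>N\<close>, so adding it to \<open>B\<close> would give a larger independent set.\<close>

lemma fd_module_maximal_submodule:
  assumes alg: "fd_algebra K A" and M: "fd_module K A M"
    and ne: "\<C> \<noteq> {}" and sub: "\<And>N. N \<in> \<C> \<Longrightarrow> Module.submodule N A M"
  obtains N where "N \<in> \<C>" "\<And>N'. N' \<in> \<C> \<Longrightarrow> N \<subseteq> N' \<Longrightarrow> N' = N"
proof -
  let ?V = "underlying_space A M"
  have lm: "left_module A M" and fin: "vectorspace.fin_dim K ?V"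
    using M by (auto simp: fd_module_def)
  interpret A: fd_algebra K A by fact
  interpret M: left_module A M by (rule lm)
  interpret V: vectorspace K ?V by (rule vectorspace_underlying_space[OF alg lm])
  define P where "P n \<longleftrightarrow> (\<exists>N \<in> \<C>. \<exists>B \<subseteq> N. V.lin_indpt B \<and> card B = n)" for n
  have bound: "n \<le> V.dim" if Pn: "P n" for n
  proof -
    obtain N B where "N \<in> \<C>" "B \<subseteq> N" "V.lin_indpt B" "card B = n"
      using Pn unfolding P_def by blast
    moreover from this have "B \<subseteq> carrier ?V"
      using M.submoduleD(1)[OF sub] by fastforce
    ultimately show ?thesis
      using V.li_le_dim(2)[OF fin] by blast
  qed
  have "V.lin_indpt {}"
    by (simp add: V.lin_dep_def)
  then have "P 0"
    using ne by (force simp: P_def)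
  then have "P (Greatest P)" and max: "\<And>n. P n \<Longrightarrow> n \<le> Greatest P"
    using bound by (blast intro: GreatestI_nat Greatest_le_nat)+
  then obtain N B where N: "N \<in> \<C>" and B: "B \<subseteq> N" "V.lin_indpt B" "card B = Greatest P"
    by (auto simp: P_def)
  note sN = M.submoduleD[OF sub[OF N]]
  have Bc: "B \<subseteq> carrier ?V"
    using B(1) sN(1) by auto
  have "LinearCombinations.submodule K N ?V"
    using sN V.module_axioms by (simp add: LinearCombinations.submodule_def)
  then have span: "V.span B \<subseteq> N"
    by (rule V.span_is_subset[OF B(1)])
  have "N' = N" if N': "N' \<in> \<C>" "N \<subseteq> N'" for N'
  proof (rule ccontr)
    assume "N' \<noteq> N"
    then obtain v where v: "v \<in> N'" "v \<notin> N"
      using N'(2) by blast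
    then have "v \<in> carrier ?V" "v \<notin> B"
      using B(1) M.submoduleD(1)[OF sub[OF N'(1)]] by auto
    then have "V.lin_indpt (B \<union> {v})"
      using V.lin_dep_iff_in_span[OF Bc B(2), of v] span v(2) by blast
    moreover have "card (B \<union> {v}) = Suc (Greatest P)"
      using V.li_le_dim(1)[OF fin Bc B(2)] B(3) \<open>v \<notin> B\<close> by simp
    ultimately have "P (Suc (Greatest P))"
      unfolding P_def using N' v(1) B(1) by (intro bexI[of _ N'] exI[of _ "B \<union> {v}"]) auto
    then show False
      using max by fastforce
  qed
  then show thesis
    using that N by blast
qed

lemma is_quotient_fd_module:
  assumes alg: "fd_algebra K A" and M: "fd_module K A M" and q: "is_quotient A M N Q p"
  shows "fd_module K A Q"
proof -
  note q' = is_quotientD[OF q]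
  interpret A: fd_algebra K A by fact
  interpret V: vectorspace K "underlying_space A M"
    by (rule vectorspace_underlying_space[OF alg q'(1)])
  interpret W: vectorspace K "underlying_space A Q"
    by (rule vectorspace_underlying_space[OF alg q'(2)])
  have "p \<in> module_hom K (underlying_space A M) (underlying_space A Q)"
    using module_hom_in_carrier[OF q'(3)] module_hom_add[OF q'(3)] module_hom_smult[OF q'(3)]
    by (intro module_homI) simp_all
  then interpret p: linear_map K "underlying_space A M" "underlying_space A Q" p
    by unfold_locales
  show ?thesis
    using p.image_fin_dim q'(2,4) M by (simp add: fd_module_def)
qed

section \<open>Traces\<close>

text \<open>First isomorphism theorem, applied to the kernel of \<open>q\<close>. Surjections from
  powers are the convenient form, as they can be extended by one more copy of
  \<open>U\<close>.\<close>

lemma in_gen_iff: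
  assumes "left_module A U"
  shows "in_gen A U N \<longleftrightarrow> left_module A N \<and>
    (\<exists>d. \<exists>q \<in> module_hom A (power_module U d) N. q ` carrier (power_module U d) = carrier N)"
proof (intro iffI conjI)
  assume gen: "in_gen A U N"
  then show N: "left_module A N"
    unfolding in_gen_def by (rule conjunct1)
  from gen obtain d L where L: "Module.submodule L A (power_module U d)"
    and "module_iso A N (quotient_module (power_module U d) L) \<noteq> {}"
    unfolding in_gen_def by (elim conjE exE)
  let ?P = "power_module U d"
  obtain h where h: "h \<in> module_iso A N (quotient_module ?P L)"
    using \<open>_ \<noteq> {}\<close> by blast
  note r = is_quotientD[OF is_quotient_quotient_module[OF left_module_power_module[OF assms] L]]
  define q where "q = inv_into (carrier N) h \<circ> (+>\<^bsub>?P\<^esub>) L"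
  have g: "inv_into (carrier N) h \<in> module_hom A (quotient_module ?P L) N"
      "inv_into (carrier N) h ` carrier (quotient_module ?P L) = carrier N"
    using module_iso_sym[OF N h] by (simp_all add: module_iso_def bij_betw_def)
  have "q \<in> module_hom A ?P N"
    unfolding q_def by (rule module_hom_comp[OF r(1,3) g(1)])
  moreover have "q ` carrier ?P = carrier N"
    unfolding q_def image_comp[symmetric] r(4) by (rule g(2))
  ultimately show
    "\<exists>d. \<exists>q \<in> module_hom A (power_module U d) N. q ` carrier (power_module U d) = carrier N"
    by blast
next
  assume "left_module A N \<and>
    (\<exists>d. \<exists>q \<in> module_hom A (power_module U d) N. q ` carrier (power_module U d) = carrier N)"
  then obtain d q where N: "left_module A N"
    and q: "q \<in> module_hom A (power_module U d) N" "q ` carrier (power_module U d) = carrier N"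
    by blast
  let ?P = "power_module U d" and ?L = "{x \<in> carrier (power_module U d). q x = \<zero>\<^bsub>N\<^esub>}"
  have quot: "is_quotient A ?P ?L N q"
    using N q left_module_power_module[OF assms] by (simp add: is_quotient_def)
  obtain h where "h \<in> module_iso A N (quotient_module ?P ?L)"
    by (rule is_quotient_unique[OF quot is_quotient_quotient_module[OF
          left_module_power_module[OF assms] is_quotient_submodule[OF quot]]])
  then have "module_iso A N (quotient_module ?P ?L) \<noteq> {}"
    by blast
  then show "in_gen A U N"
    unfolding in_gen_def
    by (intro conjI N exI[of _ d] exI[of _ ?L] is_quotient_submodule[OF quot])
qed

text \<open>The inclusion of \<open>U\<close> as coordinate \<open>k\<close>. For d \<le> k it is
  the zero map, which allows \<open>k\<close> to range over all natural numbers.\<close>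

definition single :: "('a, 'u) module \<Rightarrow> nat \<Rightarrow> nat \<Rightarrow> 'u \<Rightarrow> nat \<Rightarrow> 'u" where
  "single U d k u = (\<lambda>i\<in>{..<d}. if i = k then u else \<zero>\<^bsub>U\<^esub>)"

lemma single_in_module_hom:
  assumes "left_module A U"
  shows "single U d k \<in> module_hom A U (power_module U d)"
proof -
  interpret U: left_module A U by fact
  show ?thesis
    by (rule module_homI)
      (auto simp: single_def power_module_def U.smult_zero_right fun_eq_iff)
qed

text \<open>An element of the power is the sum of its coordinates. The induction runs over the
  number of leading coordinates that may be nonzero.\<close>

lemma power_module_image_subset:
  assumes U: "left_module A U" and M: "left_module A M" and L: "Module.submodule L A M"
    and q: "q \<in> module_hom A (power_module U d) M"
    and single: "\<And>k u. u \<in> carrier U \<Longrightarrow> q (single U d k u) \<in> L"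
  shows "q ` carrier (power_module U d) \<subseteq> L"
proof -
  interpret U: left_module A U by fact
  interpret M: left_module A M by fact
  note L = M.submoduleD[OF L]
  let ?P = "power_module U d"
  have mem: "q w \<in> L" if "k \<le> d" "w \<in> carrier ?P" "\<And>i. k \<le> i \<Longrightarrow> i < d \<Longrightarrow> w i = \<zero>\<^bsub>U\<^esub>" for k w
    using that
  proof (induction k arbitrary: w)
    case 0
    then have "w = \<zero>\<^bsub>?P\<^esub>"
      by (intro PiE_ext[of w "{..<d}" "\<lambda>_. carrier U"]) (simp_all add: power_module_def)
    then show ?case
      using module_hom_zero[OF left_module_power_module[OF U] M q] L(2) by simp
  next
    case (Suc k)
    \<comment> \<open>The element \<open>w\<close> with coordinate \<open>k\<close>, its last
      possibly nonzero one, cleared.\<close>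
    let ?v = "\<lambda>i\<in>{..<d}. if i = k then \<zero>\<^bsub>U\<^esub> else w i"
    have w: "w i \<in> carrier U" if "i < d" for i
      using that Suc.prems(2) PiE_mem[of w "{..<d}" "\<lambda>_. carrier U" i]
      by (simp add: power_module_def)
    have v: "?v \<in> carrier ?P"
      using w by (simp add: power_module_def)
    have s: "single U d k (w k) \<in> carrier ?P"
      using w Suc.prems(1) module_hom_in_carrier[OF single_in_module_hom[OF U]] by simp
    have "w = ?v \<oplus>\<^bsub>?P\<^esub> single U d k (w k)"
      using w Suc.prems(2)
      by (intro PiE_ext[of w "{..<d}" "\<lambda>_. carrier U"]) (simp_all add: power_module_def single_def)
    moreover have "q ?v \<in> L"
      using Suc.prems by (intro Suc.IH v) (simp_all add: not_less_eq_eq)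
    ultimately show ?case
      using module_hom_add[OF q v s] L(3) single w Suc.prems(1) by simp
  qed
  show ?thesis
    using mem[of d] by fastforce
qed

text \<open>The \<open>GREATEST\<close> in the definition needs a greatest element to exist. The
  candidates are the images of powers of \<open>U\<close>, and all of them lie in the closure. By
  finite dimension there is a maximal candidate; it absorbs the image of any further homomorphism
  from \<open>U\<close>, since adding that image yields a candidate again. Hence it contains the
  closure.\<close>

lemma trace_submodule_eq:
  fixes A :: "('k, 'a) module" and U :: "('a, 'u) module"
  assumes alg: "fd_algebra K A" and U: "left_module A U" and fd: "fd_module K A M"
  shows "trace_submodule A U M = trace_closure A U M {\<zero>\<^bsub>M\<^esub>}"
proof -
  let ?T = "trace_closure A U M {\<zero>\<^bsub>M\<^esub>}"
  define \<C> where "\<C> = {N. Module.submodule N A M \<and> in_gen A U (M\<lparr>carrier := N\<rparr>)}"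
  have M: "left_module A M"
    using fd by (simp add: fd_module_def)
  interpret U: left_module A U by fact
  interpret M: left_module A M by (rule M)
  note lmP = left_module_power_module[OF U]
  have T: "Module.submodule ?T A M"
    by (rule submodule_trace_closure[OF M]) simp
  have homs_restrict: "q \<in> module_hom A P (M\<lparr>carrier := N\<rparr>) \<longleftrightarrow>
      q \<in> module_hom A P M \<and> q ` carrier P \<subseteq> N" if "N \<subseteq> carrier M"
    for q N and P :: "('a, nat \<Rightarrow> 'u) module"
    using that by (auto simp: module_hom_def)
  have C_iff: "N \<in> \<C> \<longleftrightarrow> (\<exists>d. \<exists>q \<in> module_hom A (power_module U d) M. q ` carrier (power_module U d) = N)" for N
  proof
    assume "N \<in> \<C>"
    then obtain d q where "q \<in> module_hom A (power_module U d) (M\<lparr>carrier := N\<rparr>)"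
      and q: "q ` carrier (power_module U d) = N" and N: "Module.submodule N A M"
      unfolding \<C>_def in_gen_iff[OF U] by auto
    then show "\<exists>d. \<exists>q \<in> module_hom A (power_module U d) M. q ` carrier (power_module U d) = N"
      using homs_restrict[OF M.submoduleD(1)[OF N]] by blast
  next
    assume "\<exists>d. \<exists>q \<in> module_hom A (power_module U d) M. q ` carrier (power_module U d) = N"
    then obtain d q where q: "q \<in> module_hom A (power_module U d) M"
      "q ` carrier (power_module U d) = N" by blast
    then have N: "Module.submodule N A M"
      using submodule_image[OF lmP M q(1) left_module.submodule_carrier[OF lmP]] by simp
    have "q \<in> module_hom A (power_module U d) (M\<lparr>carrier := N\<rparr>)"
      using homs_restrict[OF M.submoduleD(1)[OF N]] q by auto
    then show "N \<in> \<C>"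
      using N q(2) left_module_submodule[OF M N] unfolding \<C>_def in_gen_iff[OF U] by auto
  qed
  have C_le: "N \<subseteq> ?T" if N: "N \<in> \<C>" for N
  proof -
    obtain d q where q: "q \<in> module_hom A (power_module U d) M"
      "q ` carrier (power_module U d) = N"
      using N C_iff by blast
    have "q (single U d k u) \<in> ?T" if "u \<in> carrier U" for k u
      using hom_mod_in_trace_closure[of "q \<circ> single U d k" A U M "{\<zero>\<^bsub>M\<^esub>}" u] that
        module_hom_comp[OF U single_in_module_hom[OF U] q(1)] by (simp add: hom_mod_zero[OF U M])
    then show ?thesis
      using power_module_image_subset[OF U M T q(1)] q(2) by blast
  qed
  \<comment> \<open>The empty power, d = 0, makes the zero submodule a candidate.\<close>
  have "(\<lambda>_. \<zero>\<^bsub>M\<^esub>) \<in> module_hom A (power_module U 0) M"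
    by (rule module_homI) (simp_all add: M.smult_zero_right)
  then have "\<C> \<noteq> {}"
    using C_iff by blast
  then obtain N where N: "N \<in> \<C>" and max: "\<And>N'. N' \<in> \<C> \<Longrightarrow> N \<subseteq> N' \<Longrightarrow> N' = N"
    using fd_module_maximal_submodule[OF alg fd, of \<C>] unfolding \<C>_def by blast
  have sN: "Module.submodule N A M"
    using N by (simp add: \<C>_def)
  have "?T \<subseteq> N"
  proof (rule trace_closure_least[OF sN])
    show "{\<zero>\<^bsub>M\<^esub>} \<subseteq> N"
      using M.submoduleD(2)[OF sN] by simp
    fix f u assume "f \<in> hom_mod A U M {\<zero>\<^bsub>M\<^esub>}" and u: "u \<in> carrier U"
    then have f: "f \<in> module_hom A U M"
      by (simp add: hom_mod_zero[OF U M])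
    obtain d q where q: "q \<in> module_hom A (power_module U d) M"
      "q ` carrier (power_module U d) = N"
      using N C_iff by blast
    let ?P = "power_module U d" and ?P' = "power_module U (Suc d)"
    \<comment> \<open>The map \<open>q'\<close> is \<open>q\<close> on the first \<open>d\<close>
      coordinates plus \<open>f\<close> on the new coordinate \<open>d\<close>.\<close>
    define r where "r w = restrict w {..<d}" for w :: "nat \<Rightarrow> 'u"
    define q' where "q' w = q (r w) \<oplus>\<^bsub>M\<^esub> f (w d)" for w
    have r: "r \<in> module_hom A ?P' ?P"
      by (rule module_homI) (auto simp: r_def power_module_def fun_eq_iff PiE_def Pi_def)
    have e: "(\<lambda>w. w d) \<in> module_hom A ?P' U"
      by (rule module_homI) (auto simp: power_module_def PiE_def Pi_def)
    note c = module_hom_in_carrier and qr = module_hom_comp[OF lmP r q(1), unfolded comp_def]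
      and fe = module_hom_comp[OF lmP e f, unfolded comp_def]
    have q': "q' \<in> module_hom A ?P' M"
      unfolding q'_def using c[OF qr] c[OF fe] module_hom_add[OF qr] module_hom_add[OF fe]
        module_hom_smult[OF qr] module_hom_smult[OF fe]
      by (intro module_homI) (simp_all add: M.M.a_ac M.smult_r_distr M.smult_closed)
    \<comment> \<open>Appends \<open>v\<close> as coordinate \<open>d\<close>. Taking v = 0 shows
      that the image of \<open>q'\<close> contains \<open>N\<close>, and taking w = 0 that it
      contains the image of \<open>f\<close>.\<close>
    define ext where "ext w v = (\<lambda>i\<in>{..<Suc d}. if i = d then v else w i)"
      for w :: "nat \<Rightarrow> 'u" and v
    have ext: "ext w v \<in> carrier ?P'" "q' (ext w v) = q w \<oplus>\<^bsub>M\<^esub> f v"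
      if "w \<in> carrier ?P" "v \<in> carrier U" for w v
    proof -
      show "ext w v \<in> carrier ?P'"
        using that by (auto simp: ext_def power_module_def PiE_def Pi_def)
      have "r (ext w v) = w"
        using that by (auto simp: r_def ext_def power_module_def PiE_def extensional_def fun_eq_iff)
      then show "q' (ext w v) = q w \<oplus>\<^bsub>M\<^esub> f v"
        by (simp add: q'_def ext_def)
    qed
    have f0: "f \<zero>\<^bsub>U\<^esub> = \<zero>\<^bsub>M\<^esub>" and q0: "q \<zero>\<^bsub>?P\<^esub> = \<zero>\<^bsub>M\<^esub>"
      using module_hom_zero[OF U M f] module_hom_zero[OF lmP M q(1)] by auto
    have "q w \<in> q' ` carrier ?P'" if "w \<in> carrier ?P" for w
      using ext[OF that U.M.zero_closed] f0 c[OF q(1) that] by (metis M.M.r_zero image_eqI)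
    then have "q' ` carrier ?P' = N"
      using q' q(2) C_iff by (intro max) blast+
    moreover have "\<zero>\<^bsub>?P\<^esub> \<in> carrier ?P"
      by (simp add: power_module_def)
    ultimately show "f u \<in> N"
      using ext[OF _ u, of "\<zero>\<^bsub>?P\<^esub>"] q0 c[OF f u] by (metis M.M.l_zero image_eqI)
  qed
  then have "?T = N"
    using C_le[OF N] by blast
  then show ?thesis
    unfolding trace_submodule_def using N C_le by (intro Greatest_equality) (auto simp: \<C>_def)
qed

section \<open>Lifting homomorphisms\<close>

text \<open>The class of (E, i, p) is an element of \<open>Ext1\<close>, hence is the class of the
  split extension. The resulting isomorphism \<open>h\<close> carries the obvious section of the
  direct sum to \<open>E\<close>.\<close>

lemma Ext1_zero_imp_split:
  assumes X: "left_module A X" and Y: "left_module A Y"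
    and ext: "Ext1 A X Y = {Ext1_zero A X Y}" and e: "(E, i, p) \<in> extensions A X Y"
  obtains s where "s \<in> module_hom A X E" "\<And>x. x \<in> carrier X \<Longrightarrow> p (s x) = x"
proof -
  interpret X: left_module A X by fact
  interpret Y: left_module A Y by fact
  \<comment> \<open>Reflexivity puts the extension into its own class, so that equality of classes
    yields an equivalence.\<close>
  have "id \<in> module_iso A E E"
    by (simp add: module_iso_def module_hom_def)
  then have "((E, i, p), (E, i, p)) \<in> extension_equiv A X Y"
    using e by (auto simp: extension_equiv_def intro!: bexI[of _ id])
  moreover have "extension_equiv A X Y `` {(E, i, p)} \<in> Ext1 A X Y"
    using e by (auto simp: Ext1_def quotient_def)
  ultimately have "((direct_sum Y X, inj1 Y X, snd), (E, i, p)) \<in> extension_equiv A X Y"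
    unfolding ext Ext1_zero_def by blast
  then obtain h where hE: "h \<in> module_iso A (direct_sum Y X) E"
    and h: "\<And>z. z \<in> carrier (direct_sum Y X) \<Longrightarrow> p (h z) = snd z"
    by (auto simp: extension_equiv_def)
  have j: "(\<lambda>x. (\<zero>\<^bsub>Y\<^esub>, x)) \<in> module_hom A X (direct_sum Y X)"
    by (rule module_homI) (simp_all add: direct_sum_def Y.smult_zero_right)
  have "h \<in> module_hom A (direct_sum Y X) E"
    using hE by (simp add: module_iso_def)
  then have "(\<lambda>x. h (\<zero>\<^bsub>Y\<^esub>, x)) \<in> module_hom A X E"
    using module_hom_comp[OF X j] by (simp add: comp_def)
  then show thesis
    using that h module_hom_in_carrier[OF j] by fastforce
qed

text \<open>
  The pullback of \<open>Q \<rightarrow> Q / i Y\<close> along \<open>X \<rightarrow> Q / i Y\<close> is an extension of \<open>X\<close> by \<open>Y\<close>. It is carried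
  over to the set \<open>Y \<times> X\<close> along \<open>\<phi>\<close>, and a splitting of it yields the lift.
\<close>

lemma Ext1_zero_imp_lift:
  fixes A :: "('k, 'a) module" and X :: "('a, 'x) module" and Y :: "('a, 'y) module"
  assumes X: "left_module A X" and Y: "left_module A Y" and Q: "left_module A Q"
    and ext: "Ext1 A X Y = {Ext1_zero A X Y}"
    and i: "i \<in> module_hom A Y Q" and inj: "inj_on i (carrier Y)"
    and f: "f \<in> hom_mod A X Q (i ` carrier Y)"
  obtains g where "g \<in> module_hom A X Q"
    "\<And>x. x \<in> carrier X \<Longrightarrow> g x \<ominus>\<^bsub>Q\<^esub> f x \<in> i ` carrier Y"
proof -
  interpret X: left_module A X by fact
  interpret Y: left_module A Y by fact
  interpret Q: left_module A Q by fact
  let ?I = "i ` carrier Y" and ?P = "direct_sum Q X" and ?C = "carrier Y \<times> carrier X"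
  have I: "Module.submodule ?I A Q"
    by (rule submodule_image[OF Y Q i Y.submodule_carrier])
  note fc = hom_mod_in_carrier[OF f] and ic = module_hom_in_carrier[OF i]
  define r where "r x = ?I +>\<^bsub>Q\<^esub> x" for x
  have r: "is_quotient A Q ?I (quotient_module Q ?I) r"
    unfolding r_def by (rule is_quotient_quotient_module[OF Q I])
  note r' = is_quotientD[OF r]
  have rf: "(\<lambda>x. r (f x)) \<in> module_hom A X (quotient_module Q ?I)"
    using f fc by (simp add: hom_mod_iff[OF X r])
  interpret P: left_module A ?P
    by (rule left_module_direct_sum[OF Q X])
  \<comment> \<open>The fibre product of \<open>Q\<close> and \<open>X\<close> over Q / iY, inside
    their direct sum.\<close>
  define D where "D = {z \<in> carrier ?P. r (fst z) = r (f (snd z))}"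
  \<comment> \<open>Over a point x of \<open>X\<close>, the fibre of \<open>D\<close> is the coset
    f(x) + iY. The map \<open>f\<close> thus serves as a set-theoretic section, and pairs (y, x)
    parametrise \<open>D\<close>.\<close>
  define \<phi> where "\<phi> e = (i (fst e) \<oplus>\<^bsub>Q\<^esub> f (snd e), snd e)" for e
  define \<psi> where "\<psi> = inv_into ?C \<phi>"
  have D_add: "z \<oplus>\<^bsub>?P\<^esub> w \<in> D" if "z \<in> D" "w \<in> D" for z w
    using that module_hom_add[OF rf] module_hom_add[OF r'(3)]
    by (auto simp: D_def direct_sum_def)
  have D_smult: "a \<odot>\<^bsub>?P\<^esub> z \<in> D" if "a \<in> carrier A" "z \<in> D" for a z
    using that module_hom_smult[OF rf] module_hom_smult[OF r'(3)]
    by (auto simp: D_def direct_sum_def Q.smult_closed X.smult_closed)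
  have D_zero: "\<zero>\<^bsub>?P\<^esub> \<in> D"
    using module_hom_zero[OF X r'(2) rf] module_hom_zero[OF r'(1-3)]
    by (simp add: D_def direct_sum_def)
  have D_iff: "(m, x) \<in> D \<longleftrightarrow> m \<in> carrier Q \<and> x \<in> carrier X \<and> m \<ominus>\<^bsub>Q\<^esub> f x \<in> ?I" for m x
    using is_quotient_eq_iff[OF r] fc by (auto simp: D_def direct_sum_def)
  have \<phi>_inj: "inj_on \<phi> ?C"
  proof (rule inj_onI)
    fix e e' assume e: "e \<in> ?C" "e' \<in> ?C" and eq: "\<phi> e = \<phi> e'"
    then have "i (fst e) \<oplus>\<^bsub>Q\<^esub> f (snd e) = i (fst e') \<oplus>\<^bsub>Q\<^esub> f (snd e)" and s: "snd e = snd e'"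
      by (auto simp: \<phi>_def)
    then have "i (fst e) = i (fst e')"
      using e ic fc by (auto dest: Q.M.add.right_cancel[THEN iffD1, rotated -1])
    then show "e = e'"
      using e s inj by (auto simp: prod_eq_iff dest: inj_onD)
  qed
  have \<phi>_img: "\<phi> ` ?C = D"
  proof
    have "(i y \<oplus>\<^bsub>Q\<^esub> f x) \<ominus>\<^bsub>Q\<^esub> f x = i y" if "x \<in> carrier X" "y \<in> carrier Y" for x y
      using that ic fc by (simp add: a_minus_def Q.M.a_assoc Q.M.r_neg)
    then show "\<phi> ` ?C \<subseteq> D"
      using ic fc by (auto simp: \<phi>_def D_iff)
    show "D \<subseteq> \<phi> ` ?C"
    proof
      fix z assume z: "z \<in> D"
      obtain m x where mx: "z = (m, x)" by (cases z)
      then obtain y where y: "y \<in> carrier Y" "m \<ominus>\<^bsub>Q\<^esub> f x = i y"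
        using z by (auto simp: D_iff)
      have "\<phi> (y, x) = z"
        using z mx fc Q.minus_add_cancel[of m "f x"] by (simp add: \<phi>_def D_iff flip: y(2))
      moreover have "(y, x) \<in> ?C"
        using y(1) z mx by (simp add: D_iff)
      ultimately show "z \<in> \<phi> ` ?C" by blast
    qed
  qed
  have \<psi>: "\<psi> z \<in> ?C" "\<phi> (\<psi> z) = z" if "z \<in> D" for z
    using that unfolding \<psi>_def \<phi>_img[symmetric] by (rule inv_into_into, rule f_inv_into_f)
  have \<phi>D: "\<phi> e \<in> D" if "e \<in> ?C" for e
    using that \<phi>_img by blast
  \<comment> \<open>The zero is the preimage of (0, 0) under \<open>\<phi>\<close> and in general
    not the pair of zeros, since f(0) is only known to lie in iY.\<close>
  define E :: "('a, 'y \<times> 'x) module" where "E = \<lparr>carrier = ?C, mult = undefined, one = undefined,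
    zero = \<psi> \<zero>\<^bsub>?P\<^esub>, add = \<lambda>e e'. \<psi> (\<phi> e \<oplus>\<^bsub>?P\<^esub> \<phi> e'), smult = \<lambda>a e. \<psi> (a \<odot>\<^bsub>?P\<^esub> \<phi> e)\<rparr>"
  have E_simps: "carrier E = ?C" "\<zero>\<^bsub>E\<^esub> = \<psi> \<zero>\<^bsub>?P\<^esub>"
    "e \<oplus>\<^bsub>E\<^esub> e' = \<psi> (\<phi> e \<oplus>\<^bsub>?P\<^esub> \<phi> e')" "a \<odot>\<^bsub>E\<^esub> e = \<psi> (a \<odot>\<^bsub>?P\<^esub> \<phi> e)" for e e' a
    by (simp_all add: E_def)
  have \<phi>_hom: "\<phi> \<in> module_hom A E ?P"
    using \<phi>D D_add D_smult \<psi> by (intro module_homI) (auto simp: E_simps D_def)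
  have E: "left_module A E"
    by (rule left_module_via_injection[OF P.left_module_axioms, where \<phi> = \<phi>])
      (use \<phi>_inj \<phi>D D_add D_smult D_zero \<psi> in \<open>auto simp: E_simps D_def\<close>)
  have fst: "fst \<in> module_hom A ?P Q" and snd: "snd \<in> module_hom A ?P X"
    by (auto simp: direct_sum_def module_hom_def)
  have snd_\<phi>: "snd (\<phi> e) = snd e" for e
    by (simp add: \<phi>_def)
  have sndE: "snd \<in> module_hom A E X"
    using module_hom_comp[OF E \<phi>_hom snd] by (simp add: snd_\<phi> comp_def)
  have D_zero_iff: "(m, \<zero>\<^bsub>X\<^esub>) \<in> D \<longleftrightarrow> m \<in> ?I" for m
    using module_hom_zero[OF X r'(2) rf] I Q.submoduleD(1)[OF I] r'(5)
    by (auto simp: D_def direct_sum_def)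
  \<comment> \<open>The inclusion of \<open>Y\<close> is transported along \<open>\<psi>\<close>
    too; the first component of \<open>j y\<close> need not be \<open>y\<close>, again because of
    f(0).\<close>
  define j where "j y = \<psi> (i y, \<zero>\<^bsub>X\<^esub>)" for y
  have iD: "(i y, \<zero>\<^bsub>X\<^esub>) \<in> D" if "y \<in> carrier Y" for y
    using that by (simp add: D_zero_iff)
  have jC: "j y \<in> ?C" and \<phi>j: "\<phi> (j y) = (i y, \<zero>\<^bsub>X\<^esub>)" if "y \<in> carrier Y" for y
    using \<psi>[OF iD[OF that]] by (simp_all add: j_def)
  have "j (y \<oplus>\<^bsub>Y\<^esub> y') = j y \<oplus>\<^bsub>E\<^esub> j y'" if "y \<in> carrier Y" "y' \<in> carrier Y" for y y'
    using \<phi>j[OF that(1)] \<phi>j[OF that(2)] that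
    by (simp add: E_simps direct_sum_def module_hom_add[OF i] j_def)
  moreover have "j (a \<odot>\<^bsub>Y\<^esub> y) = a \<odot>\<^bsub>E\<^esub> j y" if "a \<in> carrier A" "y \<in> carrier Y" for a y
    using \<phi>j[OF that(2)] that
    by (simp add: E_simps direct_sum_def module_hom_smult[OF i] j_def X.smult_zero_right)
  ultimately have "j \<in> module_hom A Y E"
    using jC by (intro module_homI) (simp_all add: E_simps)
  moreover have "inj_on j (carrier Y)"
    using \<phi>j inj by (intro inj_onI) (metis inj_onD prod.inject)
  moreover have "j ` carrier Y = a_kernel E X snd"
  proof
    have "snd (j y) = \<zero>\<^bsub>X\<^esub>" if "y \<in> carrier Y" for y
      using \<phi>j[OF that] snd_\<phi>[of "j y"] by simp
    then show "j ` carrier Y \<subseteq> a_kernel E X snd"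
      using jC unfolding a_kernel_eq E_simps(1) by blast
    show "a_kernel E X snd \<subseteq> j ` carrier Y"
    proof
      fix e assume "e \<in> a_kernel E X snd"
      then have e: "e \<in> ?C" "snd e = \<zero>\<^bsub>X\<^esub>"
        by (simp_all add: a_kernel_eq E_simps)
      then have \<phi>e: "\<phi> e = (fst (\<phi> e), \<zero>\<^bsub>X\<^esub>)"
        by (simp add: \<phi>_def)
      then obtain y where y: "y \<in> carrier Y" "fst (\<phi> e) = i y"
        using \<phi>D[OF e(1)] D_zero_iff[of "fst (\<phi> e)"] by auto
      then have "j y = e"
        using inj_onD[OF \<phi>_inj _ jC e(1)] \<phi>j \<phi>e by simp
      then show "e \<in> j ` carrier Y" using y(1) by blast
    qed
  qed
  moreover have "snd ` carrier E = carrier X"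
    using Y.M.zero_closed by (force simp: E_simps)
  ultimately have "(E, j, snd) \<in> extensions A X Y"
    using E sndE by (simp add: extensions_def)
  then obtain s where s: "s \<in> module_hom A X E" and s_snd: "\<And>x. x \<in> carrier X \<Longrightarrow> snd (s x) = x"
    using Ext1_zero_imp_split[OF X Y ext] by blast
  show thesis
  proof
    \<comment> \<open>The splitting lands in the fibre product over \<open>x\<close>, so its
      component in \<open>Q\<close> is congruent to f(x) modulo iY.\<close>
    show "fst \<circ> (\<phi> \<circ> s) \<in> module_hom A X Q"
      using module_hom_comp[OF X s \<phi>_hom] fst by (rule module_hom_comp[OF X])
    fix x assume x: "x \<in> carrier X"
    have "\<phi> (s x) \<in> D" "snd (\<phi> (s x)) = x"
      using \<phi>D module_hom_in_carrier[OF s x] s_snd[OF x] by (simp_all add: E_simps snd_\<phi>)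
    then show "(fst \<circ> (\<phi> \<circ> s)) x \<ominus>\<^bsub>Q\<^esub> f x \<in> ?I"
      using D_iff[of "fst (\<phi> (s x))" x] by (metis comp_apply prod.collapse)
  qed
qed

text \<open>
  As \<open>Y\<close> is simple, \<open>N\<close> and the image of \<open>g\<close> generate an extension of \<open>N\<close> by a copy of \<open>Y\<close>.
\<close>

lemma hom_mod_lift_step:
  assumes X: "left_module A X" and Y: "simple_module A Y"
    and ext: "Ext1 A X Y = {Ext1_zero A X Y}"
    and M: "left_module A M" and N: "Module.submodule N A M"
    and g: "g \<in> hom_mod A Y M N" and y0: "y0 \<in> carrier Y" "g y0 \<notin> N"
  obtains N' where "Module.submodule N' A M" "N \<subseteq> N'" "g y0 \<in> N'"
    "\<And>L. Module.submodule L A M \<Longrightarrow> N \<subseteq> L \<Longrightarrow> g ` carrier Y \<subseteq> L \<Longrightarrow> N' \<subseteq> L"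
    "\<And>f. f \<in> hom_mod A X M N' \<Longrightarrow>
      \<exists>f' \<in> hom_mod A X M N. \<forall>x \<in> carrier X. f' x \<ominus>\<^bsub>M\<^esub> f x \<in> N'"
proof -
  have Ym: "left_module A Y"
    and Ys: "\<And>L. Module.submodule L A Y \<Longrightarrow> L = {\<zero>\<^bsub>Y\<^esub>} \<or> L = carrier Y"
    using Y by (auto simp: simple_module_def)
  interpret X: left_module A X by fact
  interpret Y: left_module A Y by (rule Ym)
  interpret M: left_module A M by fact
  define \<pi> where "\<pi> x = N +>\<^bsub>M\<^esub> x" for x
  let ?Q = "quotient_module M N"
  have q: "is_quotient A M N ?Q \<pi>"
    unfolding \<pi>_def by (rule is_quotient_quotient_module[OF M N])
  note q' = is_quotientD[OF q]
  interpret Q: left_module A ?Q by (rule q'(2))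
  note gc = hom_mod_in_carrier[OF g]
  have i: "(\<lambda>y. \<pi> (g y)) \<in> module_hom A Y ?Q"
    using g gc by (simp add: hom_mod_iff[OF Ym q])
  \<comment> \<open>The kernel is a submodule of the simple module \<open>Y\<close> that misses
    \<open>y0\<close>.\<close>
  have ker: "{y \<in> carrier Y. \<pi> (g y) \<in> {\<zero>\<^bsub>?Q\<^esub>}} = {\<zero>\<^bsub>Y\<^esub>}"
  proof -
    have "y0 \<notin> {y \<in> carrier Y. \<pi> (g y) \<in> {\<zero>\<^bsub>?Q\<^esub>}}"
      using y0 gc q'(5) by blast
    then show ?thesis
      using Ys[OF submodule_preimage[OF Ym q'(2) i Q.submodule_zero]] y0(1) by blast
  qed
  have inj: "inj_on (\<lambda>y. \<pi> (g y)) (carrier Y)"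
  proof (rule inj_onI)
    fix y z assume yz: "y \<in> carrier Y" "z \<in> carrier Y" and "\<pi> (g y) = \<pi> (g z)"
    then have "\<pi> (g (y \<ominus>\<^bsub>Y\<^esub> z)) = \<zero>\<^bsub>?Q\<^esub>"
      using module_hom_minus[OF Ym q'(2) i yz] module_hom_in_carrier[OF i yz(2)]
      by (simp add: Q.minus_eq_zero_iff)
    moreover have "y \<ominus>\<^bsub>Y\<^esub> z \<in> carrier Y"
      using yz by simp
    ultimately have "y \<ominus>\<^bsub>Y\<^esub> z = \<zero>\<^bsub>Y\<^esub>"
      using ker by blast
    then show "y = z"
      using yz by (simp add: Y.minus_eq_zero_iff)
  qed
  let ?I = "(\<lambda>y. \<pi> (g y)) ` carrier Y"
  have I: "Module.submodule ?I A ?Q"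
    by (rule submodule_image[OF Ym q'(2) i Y.submodule_carrier])
  \<comment> \<open>This is N + gY, written as a preimage; N' / N is the copy \<open>?I\<close> of
    \<open>Y\<close>.\<close>
  define N' where "N' = {m \<in> carrier M. \<pi> m \<in> ?I}"
  have N': "Module.submodule N' A M"
    unfolding N'_def by (rule submodule_preimage[OF q'(1-3) I])
  show thesis
  proof
    show "Module.submodule N' A M" by (rule N')
    show "N \<subseteq> N'"
      using q'(5) Q.submoduleD(2)[OF I] unfolding N'_def by auto
    show "g y0 \<in> N'"
      using y0(1) gc by (simp add: N'_def)
    fix L assume L: "Module.submodule L A M" "N \<subseteq> L" "g ` carrier Y \<subseteq> L"
    show "N' \<subseteq> L"
    proof
      fix m assume "m \<in> N'"
      then obtain y where m: "m \<in> carrier M" and y: "y \<in> carrier Y" "\<pi> m = \<pi> (g y)"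
        by (auto simp: N'_def)
      then have "m \<ominus>\<^bsub>M\<^esub> g y \<in> L" "g y \<in> L"
        using is_quotient_eq_iff[OF q m gc[OF y(1)]] L(2,3) by blast+
      then show "m \<in> L"
        using M.submoduleD(3)[OF L(1)] M.minus_add_cancel[OF m gc[OF y(1)]] by metis
    qed
  next
    fix f assume f: "f \<in> hom_mod A X M N'"
    note fc = hom_mod_in_carrier[OF f]
    \<comment> \<open>Translates congruence modulo \<open>N'\<close> in \<open>M\<close> into
      congruence modulo \<open>?I\<close> in M / N, the setting in which the vanishing of Ext^1 can
      be applied.\<close>
    have \<pi>N': "\<pi> u \<ominus>\<^bsub>?Q\<^esub> \<pi> v \<in> ?I \<longleftrightarrow> u \<ominus>\<^bsub>M\<^esub> v \<in> N'" if "u \<in> carrier M" "v \<in> carrier M" for u v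
      using that module_hom_minus[OF q'(1-3) that] by (simp add: N'_def)
    have "\<pi> (f (x \<oplus>\<^bsub>X\<^esub> y)) \<ominus>\<^bsub>?Q\<^esub> (\<pi> (f x) \<oplus>\<^bsub>?Q\<^esub> \<pi> (f y)) \<in> ?I"
      if "x \<in> carrier X" "y \<in> carrier X" for x y
      using that f fc \<pi>N'[of "f (x \<oplus>\<^bsub>X\<^esub> y)" "f x \<oplus>\<^bsub>M\<^esub> f y"]
      by (simp add: module_hom_add[OF q'(3)] hom_mod_def)
    moreover have "\<pi> (f (a \<odot>\<^bsub>X\<^esub> x)) \<ominus>\<^bsub>?Q\<^esub> a \<odot>\<^bsub>?Q\<^esub> \<pi> (f x) \<in> ?I"
      if "a \<in> carrier A" "x \<in> carrier X" for a x
      using that f fc \<pi>N'[of "f (a \<odot>\<^bsub>X\<^esub> x)" "a \<odot>\<^bsub>M\<^esub> f x"]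
      by (simp add: module_hom_smult[OF q'(3)] hom_mod_def X.smult_closed M.smult_closed)
    ultimately have "(\<lambda>x. \<pi> (f x)) \<in> hom_mod A X ?Q ?I"
      using fc module_hom_in_carrier[OF q'(3)] unfolding hom_mod_def by simp
    from Ext1_zero_imp_lift[OF X Ym q'(2) ext i inj this] obtain h
      where h: "h \<in> module_hom A X ?Q" "\<And>x. x \<in> carrier X \<Longrightarrow> h x \<ominus>\<^bsub>?Q\<^esub> \<pi> (f x) \<in> ?I"
      by blast
    \<comment> \<open>The lift \<open>h\<close> takes values in M / N; representatives bring it back
      to \<open>M\<close>, where it is linear modulo \<open>N\<close>.\<close>
    obtain f' where f': "f' \<in> hom_mod A X M N" "\<And>x. x \<in> carrier X \<Longrightarrow> \<pi> (f' x) = h x"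
      using hom_mod_lift[OF X q h(1)] by blast
    have "f' x \<ominus>\<^bsub>M\<^esub> f x \<in> N'" if "x \<in> carrier X" for x
      using \<pi>N'[OF hom_mod_in_carrier[OF f'(1) that] fc[OF that]] h(2)[OF that] f'(2)[OF that]
      by simp
    then show "\<exists>f' \<in> hom_mod A X M N. \<forall>x \<in> carrier X. f' x \<ominus>\<^bsub>M\<^esub> f x \<in> N'"
      using f'(1) by blast
  qed
qed

text \<open>Among the submodules between \<open>N\<close> and the closure up to which maps lift,
  take a maximal one. If the image of some generator g escaped it, adjoining that copy of
  \<open>Y\<close> would give a larger such submodule.\<close>

lemma hom_mod_trace_closure_lift:
  assumes alg: "fd_algebra K A" and X: "left_module A X" and Y: "simple_module A Y"
    and ext: "Ext1 A X Y = {Ext1_zero A X Y}"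
    and fd: "fd_module K A M" and N: "Module.submodule N A M"
    and f: "f \<in> hom_mod A X M (trace_closure A Y M N)"
  shows "\<exists>f' \<in> hom_mod A X M N. \<forall>x \<in> carrier X. f' x \<ominus>\<^bsub>M\<^esub> f x \<in> trace_closure A Y M N"
proof -
  let ?T = "trace_closure A Y M N"
  have M: "left_module A M"
    using fd by (simp add: fd_module_def)
  interpret M: left_module A M by (rule M)
  \<comment> \<open>For nested submodules: every homomorphism X \<rightarrow> M / N2 factors through
    M / N1 \<rightarrow> M / N2.\<close>
  define lifts where "lifts N1 N2 \<longleftrightarrow> (\<forall>f \<in> hom_mod A X M N2. \<exists>f' \<in> hom_mod A X M N1.
    \<forall>x \<in> carrier X. f' x \<ominus>\<^bsub>M\<^esub> f x \<in> N2)" for N1 N2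
  define \<C> where "\<C> = {N'. Module.submodule N' A M \<and> N \<subseteq> N' \<and> N' \<subseteq> ?T \<and> lifts N N'}"
  have "lifts N N"
    unfolding lifts_def using hom_mod_in_carrier[of _ A X M N] M.submoduleD(2)[OF N]
    by (metis M.minus_eq_zero_iff)
  then have "N \<in> \<C>"
    using N by (simp add: \<C>_def subset_trace_closure)
  then obtain N' where "N' \<in> \<C>" and max: "\<And>L. L \<in> \<C> \<Longrightarrow> N' \<subseteq> L \<Longrightarrow> L = N'"
    using fd_module_maximal_submodule[OF alg fd, of \<C>] unfolding \<C>_def by blast
  then have N': "Module.submodule N' A M" "N \<subseteq> N'" "N' \<subseteq> ?T" "lifts N N'"
    by (auto simp: \<C>_def)
  have T: "Module.submodule ?T A M"
    by (rule submodule_trace_closure[OF M M.submoduleD(1)[OF N]])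
  have "?T \<subseteq> N'"
  proof (rule trace_closure_least[OF N'(1,2)], rule ccontr)
    fix g y0 assume g: "g \<in> hom_mod A Y M N" and y0: "y0 \<in> carrier Y" "g y0 \<notin> N'"
    \<comment> \<open>Regarded modulo the larger \<open>N'\<close>, the generator \<open>g\<close>
      is nonzero at \<open>y0\<close>, so one more step applies with base \<open>N'\<close>.\<close>
    have g': "g \<in> hom_mod A Y M N'"
      using g hom_mod_mono[OF N'(2)] by blast
    obtain N'' where N'': "Module.submodule N'' A M" "N' \<subseteq> N''" "g y0 \<in> N''"
      and least: "\<And>L. Module.submodule L A M \<Longrightarrow> N' \<subseteq> L \<Longrightarrow> g ` carrier Y \<subseteq> L \<Longrightarrow> N'' \<subseteq> L"
      and lift: "\<And>f. f \<in> hom_mod A X M N'' \<Longrightarrow>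
        \<exists>f' \<in> hom_mod A X M N'. \<forall>x \<in> carrier X. f' x \<ominus>\<^bsub>M\<^esub> f x \<in> N''"
      using hom_mod_lift_step[OF X Y ext M N'(1) g' y0] by blast
    have "N'' \<subseteq> ?T"
      using least[OF T N'(3)] hom_mod_in_trace_closure[OF g] by blast
    moreover have "lifts N N''"
      unfolding lifts_def
    proof
      fix f assume f: "f \<in> hom_mod A X M N''"
      obtain f1 where f1: "f1 \<in> hom_mod A X M N'" "\<forall>x \<in> carrier X. f1 x \<ominus>\<^bsub>M\<^esub> f x \<in> N''"
        using lift[OF f] by blast
      obtain f2 where f2: "f2 \<in> hom_mod A X M N" "\<forall>x \<in> carrier X. f2 x \<ominus>\<^bsub>M\<^esub> f1 x \<in> N'"
        using N'(4) f1(1) unfolding lifts_def by blast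
      have "f2 x \<ominus>\<^bsub>M\<^esub> f x \<in> N''" if x: "x \<in> carrier X" for x
      proof -
        \<comment> \<open>The two liftings are composed; their errors lie in \<open>N'\<close> and
          \<open>N''\<close>, hence both in \<open>N''\<close>.\<close>
        have "(f2 x \<ominus>\<^bsub>M\<^esub> f1 x) \<oplus>\<^bsub>M\<^esub> (f1 x \<ominus>\<^bsub>M\<^esub> f x) \<in> N''"
          using f1(2) f2(2) x N''(2) by (intro M.submoduleD(3)[OF N''(1)]) auto
        then show ?thesis
          using M.minus_cancel_right hom_mod_in_carrier[OF f x] hom_mod_in_carrier[OF f1(1) x]
            hom_mod_in_carrier[OF f2(1) x] by metis
      qed
      then show "\<exists>f' \<in> hom_mod A X M N. \<forall>x \<in> carrier X. f' x \<ominus>\<^bsub>M\<^esub> f x \<in> N''"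
        using f2(1) by blast
    qed
    ultimately have "N'' \<in> \<C>"
      using N'' N'(2) by (auto simp: \<C>_def)
    then show False
      using max N''(2,3) y0(2) by blast
  qed
  then have "?T = N'"
    using N'(3) by blast
  then show ?thesis
    using N'(4) f unfolding lifts_def by blast
qed

text \<open>An arbitrary upper bound \<open>L\<close> plays the role of the sum of the two closures.
  A generator f(x) is the difference of f'(x), in the closure for \<open>X\<close>, and of f'(x) -
  f(x), in the closure for \<open>Y\<close>.\<close>

lemma trace_closure_trace_closure_subset:
  assumes alg: "fd_algebra K A" and X: "left_module A X" and Y: "simple_module A Y"
    and ext: "Ext1 A X Y = {Ext1_zero A X Y}"
    and fd: "fd_module K A M" and N: "Module.submodule N A M"
    and L: "Module.submodule L A M" "trace_closure A X M N \<subseteq> L" "trace_closure A Y M N \<subseteq> L"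
  shows "trace_closure A X M (trace_closure A Y M N) \<subseteq> L"
proof (rule trace_closure_least[OF L(1,3)])
  interpret M: left_module A M
    using fd by (simp add: fd_module_def)
  fix f x assume f: "f \<in> hom_mod A X M (trace_closure A Y M N)" and x: "x \<in> carrier X"
  then obtain f' where f': "f' \<in> hom_mod A X M N" "f' x \<ominus>\<^bsub>M\<^esub> f x \<in> trace_closure A Y M N"
    using hom_mod_trace_closure_lift[OF alg X Y ext fd N f] by blast
  note c = hom_mod_in_carrier[OF f x] hom_mod_in_carrier[OF f'(1) x]
  have "f' x \<ominus>\<^bsub>M\<^esub> (f' x \<ominus>\<^bsub>M\<^esub> f x) \<in> L"
    using f' L hom_mod_in_trace_closure[OF f'(1) x] by (blast intro: M.submoduleD(6)[OF L(1)])
  moreover have "f' x \<ominus>\<^bsub>M\<^esub> (f' x \<ominus>\<^bsub>M\<^esub> f x) = f x"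
    using c by (simp add: a_minus_def M.M.minus_add M.M.r_neg1 M.M.r_neg2)
  ultimately show "f x \<in> L" by simp
qed

section \<open>Projection functors as quotient functors\<close>

text \<open>Since \<open>F\<close> preserves identities and composites only pointwise on carriers,
  \<open>G\<close> is moved across these equalities by its own congruence clause.\<close>

lemma is_functor_comp:
  fixes F :: "('a, 'm, 'n) mod_functor" and G :: "('a, 'n, 'p) mod_functor"
  assumes F: "is_functor K A F" and G: "is_functor K A G"
  shows "is_functor K A (G \<circ>\<^sub>F F)"
proof -
  have F_obj: "fd_module K A (obj_map F M)" if "fd_module K A M" for M
    using F that by (simp add: is_functor_def)
  have F_arr: "arr_map F M N f \<in> module_hom A (obj_map F M) (obj_map F N)"
    if "fd_module K A M" "fd_module K A N" "f \<in> module_hom A M N" for M N f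
    using F that by (simp add: is_functor_def)
  have F_cong: "arr_map F M N f x = arr_map F M N g x"
    if "fd_module K A M" "fd_module K A N" "f \<in> module_hom A M N" "g \<in> module_hom A M N"
      "\<And>x. x \<in> carrier M \<Longrightarrow> f x = g x" "x \<in> carrier (obj_map F M)" for M N f g x
    using F that unfolding is_functor_def by blast
  have F_id: "arr_map F M M id x = x" if "fd_module K A M" "x \<in> carrier (obj_map F M)" for M x
    using F that unfolding is_functor_def by blast
  have F_comp: "arr_map F L N (g \<circ> f) x = arr_map F M N g (arr_map F L M f x)"
    if "fd_module K A L" "fd_module K A M" "fd_module K A N" "f \<in> module_hom A L M"
      "g \<in> module_hom A M N" "x \<in> carrier (obj_map F L)" for L M N f g x
    using F that unfolding is_functor_def by blast
  have G_obj: "fd_module K A (obj_map G M)" if "fd_module K A M" for M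
    using G that by (simp add: is_functor_def)
  have G_arr: "arr_map G M N f \<in> module_hom A (obj_map G M) (obj_map G N)"
    if "fd_module K A M" "fd_module K A N" "f \<in> module_hom A M N" for M N f
    using G that by (simp add: is_functor_def)
  have G_cong: "arr_map G M N f x = arr_map G M N g x"
    if "fd_module K A M" "fd_module K A N" "f \<in> module_hom A M N" "g \<in> module_hom A M N"
      "\<And>x. x \<in> carrier M \<Longrightarrow> f x = g x" "x \<in> carrier (obj_map G M)" for M N f g x
    using G that unfolding is_functor_def by blast
  have G_id: "arr_map G M M id x = x" if "fd_module K A M" "x \<in> carrier (obj_map G M)" for M x
    using G that unfolding is_functor_def by blast
  have G_comp: "arr_map G L N (g \<circ> f) x = arr_map G M N g (arr_map G L M f x)"
    if "fd_module K A L" "fd_module K A M" "fd_module K A N" "f \<in> module_hom A L M"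
      "g \<in> module_hom A M N" "x \<in> carrier (obj_map G L)" for L M N f g x
    using G that unfolding is_functor_def by blast
  have id: "id \<in> module_hom A M M" for M :: "('a, 'm) module"
    by (simp add: module_hom_def)
  have id': "id \<in> module_hom A M M" for M :: "('a, 'n) module"
    by (simp add: module_hom_def)
  show ?thesis
    unfolding is_functor_def functor_comp_def mod_functor.simps
  proof (intro conjI allI impI ballI; (elim conjE)?)
    fix M :: "('a, 'm) module" assume M: "fd_module K A M"
    then show "fd_module K A (obj_map G (obj_map F M))"
      by (intro G_obj F_obj)
    fix x assume x: "x \<in> carrier (obj_map G (obj_map F M))"
    have "arr_map G (obj_map F M) (obj_map F M) (arr_map F M M id) x =
        arr_map G (obj_map F M) (obj_map F M) id x"
      using M x F_id[OF M] by (intro G_cong F_obj F_arr id id') auto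
    then show "arr_map G (obj_map F M) (obj_map F M) (arr_map F M M id) x = x"
      using G_id[OF F_obj[OF M] x] by simp
  next
    fix M N :: "('a, 'm) module" and f assume "fd_module K A M" "fd_module K A N" "f \<in> module_hom A M N"
    then show "arr_map G (obj_map F M) (obj_map F N) (arr_map F M N f)
        \<in> module_hom A (obj_map G (obj_map F M)) (obj_map G (obj_map F N))"
      by (intro G_arr F_obj F_arr)
  next
    fix M N :: "('a, 'm) module" and f g x assume *: "fd_module K A M" "fd_module K A N" "f \<in> module_hom A M N"
      "g \<in> module_hom A M N" "\<forall>x\<in>carrier M. f x = g x" "x \<in> carrier (obj_map G (obj_map F M))"
    then show "arr_map G (obj_map F M) (obj_map F N) (arr_map F M N f) x =
        arr_map G (obj_map F M) (obj_map F N) (arr_map F M N g) x"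
      by (intro G_cong F_obj F_arr F_cong) auto
  next
    fix L M N :: "('a, 'm) module" and f g x assume *: "fd_module K A L" "fd_module K A M" "fd_module K A N"
      "f \<in> module_hom A L M" "g \<in> module_hom A M N" and x: "x \<in> carrier (obj_map G (obj_map F L))"
    have lm: "left_module A L" "left_module A (obj_map F L)"
      using *(1) F_obj[OF *(1)] by (simp_all add: fd_module_def)
    have "arr_map G (obj_map F L) (obj_map F N) (arr_map F L N (g \<circ> f)) x =
        arr_map G (obj_map F L) (obj_map F N) (arr_map F M N g \<circ> arr_map F L M f) x"
      using * x F_comp[OF *] module_hom_comp[OF lm(1) *(4,5)]
      by (intro G_cong F_obj F_arr module_hom_comp[OF lm(2) F_arr F_arr]) auto
    also have "\<dots> = arr_map G (obj_map F M) (obj_map F N) (arr_map F M N g)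
        (arr_map G (obj_map F L) (obj_map F M) (arr_map F L M f) x)"
      using * x by (intro G_comp F_obj F_arr)
    finally show "arr_map G (obj_map F L) (obj_map F N) (arr_map F L N (g \<circ> f)) x = \<dots>" .
  qed
qed

lemma functor_comp_assoc: "H \<circ>\<^sub>F G \<circ>\<^sub>F F = H \<circ>\<^sub>F (G \<circ>\<^sub>F F)"
  by (simp add: functor_comp_def)

text \<open>A quotient of the identity functor: \<open>\<pi>\<close> is a natural surjection from
  the identity to \<open>F\<close> with kernel \<open>\<kappa>\<close>. The kernel then determines
  \<open>F\<close> up to natural isomorphism.\<close>

definition quotient_functor ::
    "'k ring \<Rightarrow> ('k, 'a) module \<Rightarrow> ('a, 'm, 'n) mod_functor \<Rightarrow> (('a, 'm) module \<Rightarrow> 'm set) \<Rightarrow> bool"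
  where "quotient_functor K A F \<kappa> \<longleftrightarrow> is_functor K A F \<and>
     (\<exists>\<pi>. (\<forall>M. fd_module K A M \<longrightarrow> is_quotient A M (\<kappa> M) (obj_map F M) (\<pi> M)) \<and>
          (\<forall>M N f. fd_module K A M \<and> fd_module K A N \<and> f \<in> module_hom A M N \<longrightarrow>
             (\<forall>x \<in> carrier M. arr_map F M N f (\<pi> M x) = \<pi> N (f x))))"

text \<open>The isomorphism of quotients with equal kernels commutes with the surjections from
  \<open>M\<close>. Naturality may be tested on elements \<pi>(x), where it becomes naturality of
  the two surjections.\<close>

lemma quotient_functor_naturally_isomorphic:
  assumes F: "quotient_functor K A F \<kappa>" and G: "quotient_functor K A G \<kappa>'"
    and \<kappa>: "\<And>M. fd_module K A M \<Longrightarrow> \<kappa> M = \<kappa>' M"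
  shows "naturally_isomorphic K A F G"
proof -
  obtain \<pi> where \<pi>: "\<And>M. fd_module K A M \<Longrightarrow> is_quotient A M (\<kappa> M) (obj_map F M) (\<pi> M)"
    and \<pi>_nat: "\<And>M N f x. fd_module K A M \<Longrightarrow> fd_module K A N \<Longrightarrow> f \<in> module_hom A M N \<Longrightarrow>
      x \<in> carrier M \<Longrightarrow> arr_map F M N f (\<pi> M x) = \<pi> N (f x)"
    using F unfolding quotient_functor_def by blast
  obtain \<rho> where \<rho>: "\<And>M. fd_module K A M \<Longrightarrow> is_quotient A M (\<kappa>' M) (obj_map G M) (\<rho> M)"
    and \<rho>_nat: "\<And>M N f x. fd_module K A M \<Longrightarrow> fd_module K A N \<Longrightarrow> f \<in> module_hom A M N \<Longrightarrow>
      x \<in> carrier M \<Longrightarrow> arr_map G M N f (\<rho> M x) = \<rho> N (f x)"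
    using G unfolding quotient_functor_def by blast
  have \<rho>': "is_quotient A M (\<kappa> M) (obj_map G M) (\<rho> M)" if "fd_module K A M" for M
    using \<rho>[OF that] \<kappa>[OF that] by simp
  \<comment> \<open>The guard stands inside the existential so that a choice of isomorphisms can be
    made for all \<open>M\<close> at once.\<close>
  have "\<forall>M. \<exists>h. fd_module K A M \<longrightarrow>
      h \<in> module_iso A (obj_map F M) (obj_map G M) \<and> (\<forall>x \<in> carrier M. h (\<pi> M x) = \<rho> M x)"
    using is_quotient_unique[OF \<pi> \<rho>'] by metis
  then obtain \<eta> where iso: "\<And>M. fd_module K A M \<Longrightarrow> \<eta> M \<in> module_iso A (obj_map F M) (obj_map G M)"
    and \<eta>: "\<And>M x. fd_module K A M \<Longrightarrow> x \<in> carrier M \<Longrightarrow> \<eta> M (\<pi> M x) = \<rho> M x"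
    by metis
  have "\<eta> N (arr_map F M N f z) = arr_map G M N f (\<eta> M z)"
    if M: "fd_module K A M" and N: "fd_module K A N" and f: "f \<in> module_hom A M N"
      and z: "z \<in> carrier (obj_map F M)" for M N f z
  proof -
    obtain x where "x \<in> carrier M" "z = \<pi> M x"
      using z is_quotientD(4)[OF \<pi>[OF M]] by blast
    then show ?thesis
      using \<pi>_nat[OF M N f] \<rho>_nat[OF M N f] \<eta>[OF M] \<eta>[OF N] module_hom_in_carrier[OF f] by simp
  qed
  then show ?thesis
    using F G iso unfolding naturally_isomorphic_def quotient_functor_def by blast
qed

section \<open>Projection functors and their composites as quotients of the identity functor\<close>

context
  fixes K :: "'k ring" and A :: "('k, 'a) module" and U :: "('a, 'u) module"
  assumes alg: "fd_algebra K A" and U: "left_module A U"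
begin

lemma is_quotient_projection_functor:
  assumes "fd_module K A M"
  shows "is_quotient A M (trace_closure A U M {\<zero>\<^bsub>M\<^esub>}) (obj_map (projection_functor A U) M)
    ((+>\<^bsub>M\<^esub>) (trace_closure A U M {\<zero>\<^bsub>M\<^esub>}))"
proof -
  interpret M: left_module A M
    using assms by (simp add: fd_module_def)
  have "Module.submodule (trace_closure A U M {\<zero>\<^bsub>M\<^esub>}) A M"
    by (rule submodule_trace_closure[OF M.left_module_axioms]) simp
  then show ?thesis
    using is_quotient_quotient_module[OF M.left_module_axioms]
    by (simp add: projection_functor_def trace_submodule_eq[OF alg U assms])
qed

text \<open>As \<open>f\<close> maps trace into trace, the coset of f(y) is the same for all
  representatives \<open>y\<close>, and the union collapses.\<close>

lemma arr_map_projection_functor: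
  assumes M: "fd_module K A M" and N: "fd_module K A N" and f: "f \<in> module_hom A M N"
    and x: "x \<in> carrier M"
  shows "arr_map (projection_functor A U) M N f (trace_closure A U M {\<zero>\<^bsub>M\<^esub>} +>\<^bsub>M\<^esub> x) =
    trace_closure A U N {\<zero>\<^bsub>N\<^esub>} +>\<^bsub>N\<^esub> f x"
proof -
  interpret M: left_module A M
    using M by (simp add: fd_module_def)
  interpret N: left_module A N
    using N by (simp add: fd_module_def)
  note lm = M.left_module_axioms N.left_module_axioms
  have TM: "Module.submodule (trace_closure A U M {\<zero>\<^bsub>M\<^esub>}) A M"
    by (rule submodule_trace_closure[OF lm(1)]) simp
  have TN: "Module.submodule (trace_closure A U N {\<zero>\<^bsub>N\<^esub>}) A N"
    by (rule submodule_trace_closure[OF lm(2)]) simp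
  have "trace_closure A U N {\<zero>\<^bsub>N\<^esub>} +>\<^bsub>N\<^esub> f y = trace_closure A U N {\<zero>\<^bsub>N\<^esub>} +>\<^bsub>N\<^esub> f x"
    if "y \<in> carrier M" "y \<ominus>\<^bsub>M\<^esub> x \<in> trace_closure A U M {\<zero>\<^bsub>M\<^esub>}" for y
    using trace_closure_image[OF U lm f that(2)] module_hom_minus[OF lm f that(1) x]
      N.a_r_coset_eq_iff[OF TN] module_hom_in_carrier[OF f] that(1) x by simp
  then show ?thesis
    using M.UN_a_r_coset[OF TM x, of "\<lambda>y. trace_closure A U N {\<zero>\<^bsub>N\<^esub>} +>\<^bsub>N\<^esub> f y"]
    by (simp add: projection_functor_def trace_submodule_eq[OF alg U M]
        trace_submodule_eq[OF alg U N])
qed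

lemma is_functor_projection_functor:
  "is_functor K A (projection_functor A U :: ('a, 'm, 'm set) mod_functor)"
proof -
  let ?F = "projection_functor A U :: ('a, 'm, 'm set) mod_functor"
  let ?p = "\<lambda>M :: ('a, 'm) module. (+>\<^bsub>M\<^esub>) (trace_closure A U M {\<zero>\<^bsub>M\<^esub>})"
  note quot = is_quotient_projection_functor and arr = arr_map_projection_functor
  have cases: "\<exists>x \<in> carrier M. z = ?p M x"
    if "fd_module K A M" "z \<in> carrier (obj_map ?F M)" for M :: "('a, 'm) module" and z
    using that is_quotientD(4)[OF quot[OF that(1)]] by blast
  have lm: "left_module A M" if "fd_module K A M" for M :: "('a, 'm) module"
    using that by (simp add: fd_module_def)
  show ?thesis
    unfolding is_functor_def
  proof (intro conjI allI impI ballI; (elim conjE)?)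
    fix M :: "('a, 'm) module" assume M: "fd_module K A M"
    show "fd_module K A (obj_map ?F M)"
      by (rule is_quotient_fd_module[OF alg M quot[OF M]])
    fix z assume "z \<in> carrier (obj_map ?F M)"
    then obtain x where "x \<in> carrier M" "z = ?p M x"
      using cases[OF M] by blast
    then show "arr_map ?F M M id z = z"
      using arr[OF M M, of id x] by (simp add: module_hom_def)
  next
    fix M N :: "('a, 'm) module" and f
    assume M: "fd_module K A M" and N: "fd_module K A N" and f: "f \<in> module_hom A M N"
    note qM = is_quotientD[OF quot[OF M]] and qN = is_quotientD[OF quot[OF N]]
    interpret M: left_module A M by (rule qM(1))
    have nat: "?p N (f x) \<in> carrier (obj_map ?F N)" if "x \<in> carrier M" for x
      by (rule module_hom_in_carrier[OF qN(3) module_hom_in_carrier[OF f that]])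
    show "arr_map ?F M N f \<in> module_hom A (obj_map ?F M) (obj_map ?F N)"
    proof (rule module_homI)
      fix z assume "z \<in> carrier (obj_map ?F M)"
      then show "arr_map ?F M N f z \<in> carrier (obj_map ?F N)"
        using cases[OF M] arr[OF M N f] nat by metis
    next
      fix z w assume "z \<in> carrier (obj_map ?F M)" "w \<in> carrier (obj_map ?F M)"
      then obtain x y where xy: "x \<in> carrier M" "z = ?p M x" "y \<in> carrier M" "w = ?p M y"
        using cases[OF M] by metis
      then show "arr_map ?F M N f (z \<oplus>\<^bsub>obj_map ?F M\<^esub> w) =
          arr_map ?F M N f z \<oplus>\<^bsub>obj_map ?F N\<^esub> arr_map ?F M N f w"
        using arr[OF M N f, of "x \<oplus>\<^bsub>M\<^esub> y"] arr[OF M N f] module_hom_in_carrier[OF f]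
        by (simp add: module_hom_add[OF f] module_hom_add[OF qM(3)] module_hom_add[OF qN(3)])
    next
      fix a z assume a: "a \<in> carrier A" and "z \<in> carrier (obj_map ?F M)"
      then obtain x where x: "x \<in> carrier M" "z = ?p M x"
        using cases[OF M] by metis
      then show "arr_map ?F M N f (a \<odot>\<^bsub>obj_map ?F M\<^esub> z) = a \<odot>\<^bsub>obj_map ?F N\<^esub> arr_map ?F M N f z"
        using a arr[OF M N f, of "a \<odot>\<^bsub>M\<^esub> x"] arr[OF M N f x(1)] module_hom_in_carrier[OF f x(1)]
          module_hom_smult[OF f a x(1)] module_hom_smult[OF qM(3) a x(1)]
          module_hom_smult[OF qN(3) a, of "f x"]
        by (simp add: M.smult_closed)
    qed
  next
    fix M N :: "('a, 'm) module" and f g z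
    assume M: "fd_module K A M" and N: "fd_module K A N" and f: "f \<in> module_hom A M N"
      and g: "g \<in> module_hom A M N" and eq: "\<forall>x \<in> carrier M. f x = g x"
      and z: "z \<in> carrier (obj_map ?F M)"
    obtain x where "x \<in> carrier M" "z = ?p M x"
      using cases[OF M z] by blast
    then show "arr_map ?F M N f z = arr_map ?F M N g z"
      using arr[OF M N f] arr[OF M N g] eq by simp
  next
    fix L M N :: "('a, 'm) module" and f g z
    assume L: "fd_module K A L" and M: "fd_module K A M" and N: "fd_module K A N"
      and f: "f \<in> module_hom A L M" and g: "g \<in> module_hom A M N"
      and z: "z \<in> carrier (obj_map ?F L)"
    obtain x where x: "x \<in> carrier L" "z = ?p L x"
      using cases[OF L z] by blast
    then show "arr_map ?F L N (g \<circ> f) z = arr_map ?F M N g (arr_map ?F L M f z)"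
      using arr[OF L N module_hom_comp[OF lm[OF L] f g] x(1)] arr[OF L M f x(1)]
        arr[OF M N g module_hom_in_carrier[OF f x(1)]] by simp
  qed
qed

lemma quotient_functor_projection_functor:
  "quotient_functor K A (projection_functor A U) (\<lambda>M. trace_closure A U M {\<zero>\<^bsub>M\<^esub>})"
  unfolding quotient_functor_def
  by (intro conjI exI[of _ "\<lambda>M. (+>\<^bsub>M\<^esub>) (trace_closure A U M {\<zero>\<^bsub>M\<^esub>})"] allI impI ballI
      is_functor_projection_functor is_quotient_projection_functor arr_map_projection_functor) auto

text \<open>The kernel of the composite surjection is the preimage of the trace of
  \<open>F M\<close>, which \<open>trace_closure_preimage\<close> identifies with the closure of
  \<kappa>(M). Repeated use gives the kernel of any composite of projections.\<close>

lemma quotient_functor_projection_functor_comp: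
  assumes "quotient_functor K A F \<kappa>"
  shows "quotient_functor K A (projection_functor A U \<circ>\<^sub>F F) (\<lambda>M. trace_closure A U M (\<kappa> M))"
proof -
  let ?P = "projection_functor A U" and ?t = "\<lambda>M. trace_closure A U M {\<zero>\<^bsub>M\<^esub>}"
  have F: "is_functor K A F"
    using assms by (simp add: quotient_functor_def)
  obtain \<pi> where \<pi>: "\<And>M. fd_module K A M \<Longrightarrow> is_quotient A M (\<kappa> M) (obj_map F M) (\<pi> M)"
    and nat: "\<And>M N f x. fd_module K A M \<Longrightarrow> fd_module K A N \<Longrightarrow> f \<in> module_hom A M N \<Longrightarrow>
      x \<in> carrier M \<Longrightarrow> arr_map F M N f (\<pi> M x) = \<pi> N (f x)"
    using assms unfolding quotient_functor_def by blast
  have obj: "fd_module K A (obj_map F M)" if "fd_module K A M" for M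
    using F that by (simp add: is_functor_def)
  have "is_quotient A M (trace_closure A U M (\<kappa> M)) (obj_map (?P \<circ>\<^sub>F F) M)
      (\<lambda>x. ?t (obj_map F M) +>\<^bsub>obj_map F M\<^esub> \<pi> M x)" if M: "fd_module K A M" for M
    using is_quotient_comp[OF \<pi>[OF M] is_quotient_projection_functor[OF obj[OF M]]]
    unfolding trace_closure_preimage[OF U \<pi>[OF M]] by (simp add: functor_comp_def)
  moreover have "arr_map (?P \<circ>\<^sub>F F) M N f (?t (obj_map F M) +>\<^bsub>obj_map F M\<^esub> \<pi> M x) =
      ?t (obj_map F N) +>\<^bsub>obj_map F N\<^esub> \<pi> N (f x)"
    if M: "fd_module K A M" and N: "fd_module K A N" and f: "f \<in> module_hom A M N"
      and x: "x \<in> carrier M" for M N f x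
  proof -
    have "arr_map F M N f \<in> module_hom A (obj_map F M) (obj_map F N)"
      using F M N f by (simp add: is_functor_def)
    then show ?thesis
      using arr_map_projection_functor[OF obj[OF M] obj[OF N]] nat[OF M N f x]
        module_hom_in_carrier[OF is_quotientD(3)[OF \<pi>[OF M]] x]
      by (simp add: functor_comp_def)
  qed
  ultimately show ?thesis
    unfolding quotient_functor_def using is_functor_comp[OF F is_functor_projection_functor]
    by (intro conjI exI[of _ "\<lambda>M x. ?t (obj_map F M) +>\<^bsub>obj_map F M\<^esub> \<pi> M x"]) auto
qed

end

theorem proposition1p1:
  fixes K :: "'k ring" and A :: "('k, 'a) module"
    and S :: "('a, 's) module" and T :: "('a, 't) module"
  assumes "field K" and "fd_algebra K A"
    and "simple_module A S" and "simple_module A T"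
    and "Ext1 A S S = {Ext1_zero A S S}" and "Ext1 A T T = {Ext1_zero A T T}"
  shows
    "naturally_isomorphic K A
       (projection_functor A S \<circ>\<^sub>F projection_functor A S)
       (projection_functor A S :: ('a, 'm, 'm set) mod_functor) \<and>
     (Ext1 A T S = {Ext1_zero A T S} \<longrightarrow>
       naturally_isomorphic K A
         (projection_functor A S \<circ>\<^sub>F projection_functor A T \<circ>\<^sub>F projection_functor A S)
         (projection_functor A T \<circ>\<^sub>F projection_functor A S \<circ>\<^sub>F projection_functor A T
           :: ('a, 'm, 'm set set set) mod_functor) \<and>
       naturally_isomorphic K A
         (projection_functor A T \<circ>\<^sub>F projection_functor A S \<circ>\<^sub>F projection_functor A T)
         (projection_functor A S \<circ>\<^sub>F projection_functor A T
           :: ('a, 'm, 'm set set) mod_functor))"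
proof -
  have S: "left_module A S" and T: "left_module A T"
    using assms(3,4) by (simp_all add: simple_module_def)
  let ?S = "trace_closure A S" and ?T = "trace_closure A T"
  have sub: "Module.submodule {\<zero>\<^bsub>M\<^esub>} A M"
    "\<And>N. Module.submodule N A M \<Longrightarrow> Module.submodule (?S M N) A M"
    "\<And>N. Module.submodule N A M \<Longrightarrow> Module.submodule (?T M N) A M"
    if "fd_module K A M" for M :: "('a, 'm) module"
  proof -
    interpret M: left_module A M
      using that by (simp add: fd_module_def)
    show "Module.submodule {\<zero>\<^bsub>M\<^esub>} A M" by (rule M.submodule_zero)
    show "\<And>N. Module.submodule N A M \<Longrightarrow> Module.submodule (?S M N) A M"
      "\<And>N. Module.submodule N A M \<Longrightarrow> Module.submodule (?T M N) A M"
      by (intro submodule_trace_closure M.left_module_axioms M.submoduleD(1); assumption)+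
  qed
  have mono: "?S M N \<subseteq> ?S M N'" "?T M N \<subseteq> ?T M N'"
    if "fd_module K A M" "Module.submodule N' A M" "N \<subseteq> N'" for M :: "('a, 'm) module" and N N'
  proof -
    have M: "left_module A M"
      using that(1) by (simp add: fd_module_def)
    show "?S M N \<subseteq> ?S M N'" "?T M N \<subseteq> ?T M N'"
      by (rule trace_closure_mono[OF M left_module.submoduleD(1)[OF M that(2)] that(3)])+
  qed
  note subset = subset_trace_closure
    and collapse = trace_closure_trace_closure_subset[OF assms(2)]
  \<comment> \<open>Self-extensions enter here: \<open>collapse\<close> with both modules equal to
    \<open>S\<close> and the closure itself as upper bound.\<close>
  have SS: "?S M (?S M N) = ?S M N" if M: "fd_module K A M" and N: "Module.submodule N A M"
    for M :: "('a, 'm) module" and N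
    by (intro equalityI collapse[OF S assms(3,5) M N] sub(2)[OF M N] subset order_refl)
  have TT: "?T M (?T M N) = ?T M N" if M: "fd_module K A M" and N: "Module.submodule N A M"
    for M :: "('a, 'm) module" and N
    by (intro equalityI collapse[OF T assms(4,6) M N] sub(3)[OF M N] subset order_refl)
  note PS = quotient_functor_projection_functor[OF assms(2) S]
    and PT = quotient_functor_projection_functor[OF assms(2) T]
    and PS_comp = quotient_functor_projection_functor_comp[OF assms(2) S]
    and PT_comp = quotient_functor_projection_functor_comp[OF assms(2) T]
  have "naturally_isomorphic K A (projection_functor A S \<circ>\<^sub>F projection_functor A S)
      (projection_functor A S :: ('a, 'm, 'm set) mod_functor)"
    by (rule quotient_functor_naturally_isomorphic[OF PS_comp[OF PS] PS]) (simp add: SS sub(1))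
  moreover have
    "naturally_isomorphic K A
       (projection_functor A S \<circ>\<^sub>F projection_functor A T \<circ>\<^sub>F projection_functor A S)
       (projection_functor A T \<circ>\<^sub>F projection_functor A S \<circ>\<^sub>F projection_functor A T
         :: ('a, 'm, 'm set set set) mod_functor) \<and>
     naturally_isomorphic K A
       (projection_functor A T \<circ>\<^sub>F projection_functor A S \<circ>\<^sub>F projection_functor A T)
       (projection_functor A S \<circ>\<^sub>F projection_functor A T :: ('a, 'm, 'm set set) mod_functor)"
    if ext: "Ext1 A T S = {Ext1_zero A T S}"
  proof -
    have TS: "?T M (?S M N) \<subseteq> L"
      if "fd_module K A M" "Module.submodule N A M" "Module.submodule L A M"
        "?T M N \<subseteq> L" "?S M N \<subseteq> L" for M :: "('a, 'm) module" and N L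
      using collapse[OF T assms(3) ext that] .
    have TST: "?T M (?S M (?T M {\<zero>\<^bsub>M\<^esub>})) = ?S M (?T M {\<zero>\<^bsub>M\<^esub>})"
      if M: "fd_module K A M" for M :: "('a, 'm) module"
    proof (intro equalityI subset)
      note s = sub[OF M]
      show "?T M (?S M (?T M {\<zero>\<^bsub>M\<^esub>})) \<subseteq> ?S M (?T M {\<zero>\<^bsub>M\<^esub>})"
        \<comment> \<open>The base is the \<open>T\<close>-closure of 0; its own
          \<open>T\<close>-closure stays below the bound by idempotence.\<close>
        using s by (intro TS[OF M]) (simp_all add: TT[OF M] subset)
    qed
    have STS: "?S M (?T M (?S M {\<zero>\<^bsub>M\<^esub>})) = ?S M (?T M {\<zero>\<^bsub>M\<^esub>})"
      if M: "fd_module K A M" for M :: "('a, 'm) module"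
    proof
      note s = sub[OF M]
      \<comment> \<open>The base is now 0. Its \<open>T\<close>-closure lies below the bound by
        extensivity of the \<open>S\<close>-closure, its \<open>S\<close>-closure by
        monotonicity.\<close>
      have "?T M (?S M {\<zero>\<^bsub>M\<^esub>}) \<subseteq> ?S M (?T M {\<zero>\<^bsub>M\<^esub>})"
        using s by (intro TS[OF M] mono[OF M] subset) simp_all
      then have "?S M (?T M (?S M {\<zero>\<^bsub>M\<^esub>})) \<subseteq> ?S M (?S M (?T M {\<zero>\<^bsub>M\<^esub>}))"
        using s by (intro mono[OF M]) simp_all
      then show "?S M (?T M (?S M {\<zero>\<^bsub>M\<^esub>})) \<subseteq> ?S M (?T M {\<zero>\<^bsub>M\<^esub>})"
        using s by (simp add: SS[OF M])
      show "?S M (?T M {\<zero>\<^bsub>M\<^esub>}) \<subseteq> ?S M (?T M (?S M {\<zero>\<^bsub>M\<^esub>}))"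
        using s by (intro mono[OF M] subset) simp_all
    qed
    show ?thesis
      \<comment> \<open>Composition of functors is parsed to the left, while kernels are computed by
        adding projections on the left of a composite.\<close>
      unfolding functor_comp_assoc
      by (intro conjI quotient_functor_naturally_isomorphic[OF PS_comp[OF PT_comp[OF PS]]
            PT_comp[OF PS_comp[OF PT]]]
          quotient_functor_naturally_isomorphic[OF PT_comp[OF PS_comp[OF PT]] PS_comp[OF PT]])
        (simp_all add: TST STS)
  qed
  ultimately show ?thesis by blast
qed

end
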